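(* Let $(\mathbb{R}^{n+2},g_S)$ be a conformally curved Cahen-Wallach space. Then a group $\Gamma$ of conformal transformations of $(\mathbb{R}^{n+2},g_S)$ that centralises an essential homothety $\eta$ of $(\mathbb{R}^{n+2},g_S)$ (i.e. $\gamma\eta=\eta\gamma$ for all $\gamma\in\Gamma$) cannot act properly discontinuously and cocompactly on $\mathbb{R}^{n+2}$.
   Context: For $n\ge 1$ and a real symmetric $n\times n$ matrix $S$ with $\det S\neq 0$, the Cahen-Wallach space $(\mathbb{R}^{n+2},g_S)$ is $\mathbb{R}^{n+2}$ with global coordinates $(t,x,v)$, $t,v\in\mathbb{R}$, $x\in\mathbb{R}^n$, and Lorentzian metric $g_S=2\,dv\,dt+(x^\top S x)\,dt^2+dx^\top dx$. It is conformally curved if it is not conformally flat, i.e. not every point has a neighbourhood admitting a conformal diffeomorphism into a flat semi-Riemannian manifold. A conformal transformation of a semi-Riemannian manifold $(N,g)$ is a diffeomorphism $\phi:N\to N$ with $\phi^*g=e^{2f}g$ for some smooth function $f$ on $N$; it is a homothety if $f$ is constant. A conformal transformation $\phi$ is essential if there is no smooth function $h$ on $N$ such that $\phi$ is an isometry of $e^{2h}g$. A group $\Gamma$ of diffeomorphisms of a manifold $N$ acts properly discontinuously if (PD1) each $x\in N$ has a neighbourhood $U$ such that $\gamma U\cap U\ne\emptyset$ with $\gamma\in\Gamma$ implies that $\gamma$ is the identity; and (PD2) all $x,y\in N$ in different $\Gamma$-orbits have neighbourhoods $U\ni x$, $V\ni y$ with $\gamma U\cap V=\emptyset$ for all $\gamma\in\Gamma$.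 It acts cocompactly if the orbit space $N/\Gamma$ is compact. *)

theory Defs
  imports "HOL-Analysis.Analysis" "HOL-Algebra.Bij"
begin

section \<open>Smooth maps\<close>

text \<open>
  The set \<open>U\<close> is meant to be open throughout, so that \<^term>\<open>frechet_derivative f (at x)\<close> only
  depends on \<open>f\<close> on \<open>U\<close>.  In finite dimension, quantifying over all constant directions \<open>v\<close>
  gives the usual notion of \<open>k\<close>-fold continuous differentiability.
\<close>

primrec Ck_on :: "nat \<Rightarrow> 'a::euclidean_space set \<Rightarrow> ('a \<Rightarrow> 'b::euclidean_space) \<Rightarrow> bool" where
  "Ck_on 0 U f \<longleftrightarrow> continuous_on U f"
| "Ck_on (Suc k) U f \<longleftrightarrow>
     (\<forall>x\<in>U. f differentiable (at x)) \<and>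
     (\<forall>v. Ck_on k U (\<lambda>x. frechet_derivative f (at x) v))"

definition smooth_on :: "'a::euclidean_space set \<Rightarrow> ('a \<Rightarrow> 'b::euclidean_space) \<Rightarrow> bool" where
  "smooth_on U f \<longleftrightarrow> (\<forall>k. Ck_on k U f)"

definition diffeo_on ::
    "'a::euclidean_space set \<Rightarrow> 'b::euclidean_space set \<Rightarrow> ('a \<Rightarrow> 'b) \<Rightarrow> bool" where
  "diffeo_on U W \<phi> \<longleftrightarrow> bij_betw \<phi> U W \<and> smooth_on U \<phi> \<and> smooth_on W (inv_into U \<phi>)"


section \<open>Semi-Riemannian metrics on open sets, curvature, conformal flatness\<close>

text \<open>
  A metric assigns to each point \<open>p\<close> a bilinear form on the tangent space at \<open>p\<close>, which is
  identified with the ambient vector space.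
\<close>

type_synonym 'a metric_field = "'a \<Rightarrow> 'a \<Rightarrow> 'a \<Rightarrow> real"

definition semi_riemannian_on :: "'a::euclidean_space set \<Rightarrow> 'a metric_field \<Rightarrow> bool" where
  "semi_riemannian_on U g \<longleftrightarrow>
     (\<forall>p\<in>U. bilinear (g p) \<and> (\<forall>X Y. g p X Y = g p Y X)
            \<and> (\<forall>X. (\<forall>Y. g p X Y = 0) \<longrightarrow> X = 0)) \<and>
     (\<forall>X Y. smooth_on U (\<lambda>p. g p X Y))"

text \<open>
  The Levi-Civita connection on constant vector fields, \<open>christoffel g p X Y = \<nabla>\<^sub>X Y\<close> at \<open>p\<close>, given
  by the Koszul formula (all Lie brackets of constant fields vanish), and the Riemann curvature
  \<open>R(X,Y)Z = \<nabla>\<^sub>X \<nabla>\<^sub>Y Z - \<nabla>\<^sub>Y \<nabla>\<^sub>X Z\<close> of constant fields.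
\<close>

definition christoffel :: "'a::euclidean_space metric_field \<Rightarrow> 'a \<Rightarrow> 'a \<Rightarrow> 'a \<Rightarrow> 'a" where
  "christoffel g p X Y = (THE V. \<forall>Z. 2 * g p V Z =
       frechet_derivative (\<lambda>q. g q Y Z) (at p) X
     + frechet_derivative (\<lambda>q. g q X Z) (at p) Y
     - frechet_derivative (\<lambda>q. g q X Y) (at p) Z)"

definition riemann_curvature ::
    "'a::euclidean_space metric_field \<Rightarrow> 'a \<Rightarrow> 'a \<Rightarrow> 'a \<Rightarrow> 'a \<Rightarrow> 'a" where
  "riemann_curvature g p X Y Z =
       frechet_derivative (\<lambda>q. christoffel g q Y Z) (at p) X
     - frechet_derivative (\<lambda>q. christoffel g q X Z) (at p) Y
     + christoffel g p X (christoffel g p Y Z)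
     - christoffel g p Y (christoffel g p X Z)"

definition flat_on :: "'a::euclidean_space set \<Rightarrow> 'a metric_field \<Rightarrow> bool" where
  "flat_on U g \<longleftrightarrow> (\<forall>p\<in>U. \<forall>X Y Z. riemann_curvature g p X Y Z = 0)"

definition pullback_metric ::
    "('a \<Rightarrow> 'b) \<Rightarrow> 'b::euclidean_space metric_field \<Rightarrow> 'a::euclidean_space metric_field" where
  "pullback_metric \<phi> h = (\<lambda>p X Y.
     h (\<phi> p) (frechet_derivative \<phi> (at p) X) (frechet_derivative \<phi> (at p) Y))"

definition conformal_diffeo ::
    "'a::euclidean_space set \<Rightarrow> 'a metric_field \<Rightarrow> 'b::euclidean_space set \<Rightarrow> 'b metric_field
      \<Rightarrow> ('a \<Rightarrow> 'b) \<Rightarrow> ('a \<Rightarrow> real) \<Rightarrow> bool" where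
  "conformal_diffeo U g W h \<phi> f \<longleftrightarrow>
     diffeo_on U W \<phi> \<and> smooth_on U f \<and>
     (\<forall>p\<in>U. \<forall>X Y. pullback_metric \<phi> h p X Y = exp (2 * f p) * g p X Y)"

text \<open>
  A diffeomorphism of a neighbourhood \<open>U\<close> into a flat manifold is one onto an open subset of that
  manifold, which is again flat and is covered by a single chart because \<open>U\<close> is.  Hence the flat
  target can be taken to be an open set \<open>W\<close> of the same vector space with some flat metric \<open>h\<close>.
\<close>

definition conformally_flat_on :: "'a::euclidean_space set \<Rightarrow> 'a metric_field \<Rightarrow> bool" where
  "conformally_flat_on N g \<longleftrightarrow>
     (\<forall>p\<in>N. \<exists>U (W :: 'a set) h \<phi> f. open U \<and> p \<in> U \<and> U \<subseteq> N \<and> open W \<and>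
        semi_riemannian_on W h \<and> flat_on W h \<and> conformal_diffeo U g W h \<phi> f)"


section \<open>Conformal transformations, homotheties, essential transformations\<close>

text \<open>The manifold is a whole Euclidean vector space.\<close>

definition conformal_transformation ::
    "'a::euclidean_space metric_field \<Rightarrow> ('a \<Rightarrow> 'a) \<Rightarrow> bool" where
  "conformal_transformation g \<phi> \<longleftrightarrow> (\<exists>f. conformal_diffeo UNIV g UNIV g \<phi> f)"

definition homothety :: "'a::euclidean_space metric_field \<Rightarrow> ('a \<Rightarrow> 'a) \<Rightarrow> bool" where
  "homothety g \<phi> \<longleftrightarrow> (\<exists>c. conformal_diffeo UNIV g UNIV g \<phi> (\<lambda>p. c))"

definition isometry :: "'a::euclidean_space metric_field \<Rightarrow> ('a \<Rightarrow> 'a) \<Rightarrow> bool" where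
  "isometry g \<phi> \<longleftrightarrow> diffeo_on UNIV UNIV \<phi> \<and> pullback_metric \<phi> g = g"

definition essential :: "'a::euclidean_space metric_field \<Rightarrow> ('a \<Rightarrow> 'a) \<Rightarrow> bool" where
  "essential g \<phi> \<longleftrightarrow> conformal_transformation g \<phi> \<and>
     \<not> (\<exists>h. smooth_on UNIV h \<and> isometry (\<lambda>p X Y. exp (2 * h p) * g p X Y) \<phi>)"


section \<open>Cahen-Wallach spaces\<close>

text \<open>
  Points and tangent vectors are triples \<open>(t, x, v)\<close>; \<open>2 dv dt\<close> is the symmetric product, i.e. the
  quadratic form taking \<open>(a, \<xi>, b)\<close> to \<open>2 a b\<close>.
\<close>

definition cw_metric :: "real^'n^'n \<Rightarrow> (real \<times> (real^'n) \<times> real) metric_field" where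
  "cw_metric S = (\<lambda>(t, x, v) (a, \<xi>, b) (a', \<xi>', b').
     b * a' + a * b' + (x \<bullet> (S *v x)) * (a * a') + \<xi> \<bullet> \<xi>')"


section \<open>Properly discontinuous and cocompact group actions\<close>

definition group_orbit :: "('a \<Rightarrow> 'a) set \<Rightarrow> 'a \<Rightarrow> 'a set" where
  "group_orbit \<Gamma> x = (\<lambda>\<gamma>. \<gamma> x) ` \<Gamma>"

definition properly_discontinuous :: "('a::topological_space \<Rightarrow> 'a) set \<Rightarrow> bool" where
  "properly_discontinuous \<Gamma> \<longleftrightarrow>
     (\<forall>x. \<exists>U. open U \<and> x \<in> U \<and> (\<forall>\<gamma>\<in>\<Gamma>. \<gamma> ` U \<inter> U \<noteq> {} \<longrightarrow> \<gamma> = id)) \<and>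
     (\<forall>x y. group_orbit \<Gamma> x \<noteq> group_orbit \<Gamma> y \<longrightarrow>
        (\<exists>U V. open U \<and> x \<in> U \<and> open V \<and> y \<in> V \<and> (\<forall>\<gamma>\<in>\<Gamma>. \<gamma> ` U \<inter> V = {})))"

text \<open>The set of orbits with the quotient topology.\<close>

definition orbit_space :: "('a::topological_space \<Rightarrow> 'a) set \<Rightarrow> 'a set topology" where
  "orbit_space \<Gamma> =
     topology (\<lambda>W. W \<subseteq> range (group_orbit \<Gamma>) \<and> open (group_orbit \<Gamma> -` W))"

lemma openin_orbit_space:
  "openin (orbit_space \<Gamma>) W \<longleftrightarrow> W \<subseteq> range (group_orbit \<Gamma>) \<and> open (group_orbit \<Gamma> -` W)"
proof -
  have "istopology (\<lambda>W. W \<subseteq> range (group_orbit \<Gamma>) \<and> open (group_orbit \<Gamma> -` W))"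
    unfolding istopology_def by (auto simp: vimage_Union)
  then show ?thesis
    by (simp add: orbit_space_def)
qed

definition cocompact :: "('a::topological_space \<Rightarrow> 'a) set \<Rightarrow> bool" where
  "cocompact \<Gamma> \<longleftrightarrow> compact_space (orbit_space \<Gamma>)"

end

theory Submission imports Defs begin

text \<open>
  Since the space is not conformally flat, \<open>S\<close> is not a multiple of the identity.  The time component
  \<open>t\<close> of a homothety \<open>\<eta>\<close> is \<open>\<alpha> t + \<beta>\<close>, and then \<open>\<alpha>\<^sup>2 S\<close> is similar to \<open>S\<close>, so that \<open>\<alpha> = \<plusminus>1\<close>.  If \<open>\<eta>\<close> is
  essential, its factor \<open>e\<^bsup>2c\<^esup>\<close> is not 1, and \<open>\<alpha> = 1\<close> forces \<open>\<beta> = 0\<close>: otherwise \<open>\<eta>\<close> is an isometry of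
  \<open>e\<^bsup>2h\<^esup> g\<close> for \<open>h = - c t / \<beta>\<close>.  On each invariant slice \<open>t = const\<close> the map \<open>\<eta>\<close> or its inverse is a
  contraction.

  If \<open>\<alpha> = -1\<close>, then \<open>\<eta>\<close> has exactly one fixed point; \<open>\<Gamma>\<close> fixes it and is trivial by (PD1).  If \<open>\<alpha> = 1\<close>,
  the fixed points form a curve parametrised by \<open>t\<close>, which \<open>\<Gamma>\<close> preserves.  For \<open>\<gamma> \<in> \<Gamma>\<close> the conformal
  factor and the time component of \<open>\<gamma>\<close> are invariant under \<open>\<eta>\<close>, hence determined by their values on the
  curve, hence functions of \<open>t\<close> alone.  The second derivatives of \<open>\<gamma>\<close> then show that \<open>\<tau>\<^sup>2 S\<close> is similar to
  \<open>S + q I\<close>, where \<open>\<tau>\<close> is the derivative of the time component; as \<open>S\<close> is not scalar, \<open>\<gamma>\<close> acts on \<open>t\<close> by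
  \<open>\<plusminus>t + b\<close>.  By (PD1) on the curve, only finitely many elements of \<open>\<Gamma>\<close> move a point of a given
  compact set \<open>K\<close> into the slice \<open>t = 0\<close>, so the translates of \<open>K\<close> meet this unbounded slice in a bounded
  set, and \<open>\<Gamma>\<close> is not cocompact.
\<close>

section \<open>Smooth maps and second derivatives\<close>

text \<open>Schwarz's theorem. The mean value theorem, applied once along X and once along Y, turns
  the second difference of f over a small parallelogram into \<open>s * s\<close> times a value of
  \<open>f'' _ X Y\<close> nearby. That difference is symmetric in X and Y, so letting s shrink
  identifies both values at p.\<close>

lemma symmetric_second_frechet:
  fixes f :: "'a::real_normed_vector \<Rightarrow> real"
  assumes f: "\<And>q. (f has_derivative f' q) (at q)"
    and f2: "\<And>q Z. ((\<lambda>q. f' q Z) has_derivative f'' q Z) (at q)"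
    and cont: "\<And>Z W. continuous_on UNIV (\<lambda>q. f'' q Z W)"
  shows "f'' p X Y = f'' p Y X"
proof -
  have second_difference: "\<exists>r. \<exists>r'. 0 \<le> r \<and> r \<le> s \<and> 0 \<le> r' \<and> r' \<le> s \<and>
      f (p + s *\<^sub>R X + s *\<^sub>R Y) - f (p + s *\<^sub>R X) - f (p + s *\<^sub>R Y) + f p
        = s * s * f'' (p + r *\<^sub>R X + r' *\<^sub>R Y) X Y" if "s > 0" for s X Y
  proof -
    have "((\<lambda>r. f (p + r *\<^sub>R X + s *\<^sub>R Y) - f (p + r *\<^sub>R X)) has_derivative
        (\<lambda>h. f' (p + r *\<^sub>R X + s *\<^sub>R Y) (h *\<^sub>R X) - f' (p + r *\<^sub>R X) (h *\<^sub>R X))) (at r within {0..s})" for r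
      by (rule derivative_eq_intros has_derivative_compose[OF _ f] refl | simp)+
    from mvt_simple[OF that this] obtain r where r: "r \<in> {0<..<s}"
      and "f (p + s *\<^sub>R X + s *\<^sub>R Y) - f (p + s *\<^sub>R X) - f (p + s *\<^sub>R Y) + f p
        = f' (p + r *\<^sub>R X + s *\<^sub>R Y) (s *\<^sub>R X) - f' (p + r *\<^sub>R X) (s *\<^sub>R X)"
      by auto
    moreover have "linear (f' q)" for q
      using f[of q] has_derivative_linear by blast
    ultimately have 1: "f (p + s *\<^sub>R X + s *\<^sub>R Y) - f (p + s *\<^sub>R X) - f (p + s *\<^sub>R Y) + f p
        = s * (f' (p + r *\<^sub>R X + s *\<^sub>R Y) X - f' (p + r *\<^sub>R X) X)"
      by (simp add: linear_cmul right_diff_distrib)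
    have "((\<lambda>r'. f' (p + r *\<^sub>R X + r' *\<^sub>R Y) X) has_derivative
        (\<lambda>h. f'' (p + r *\<^sub>R X + r' *\<^sub>R Y) X (h *\<^sub>R Y))) (at r' within {0..s})" for r'
      by (rule derivative_eq_intros has_derivative_compose[OF _ f2] refl | simp)+
    from mvt_simple[OF that this] obtain r' where r': "r' \<in> {0<..<s}"
      and "f' (p + r *\<^sub>R X + s *\<^sub>R Y) X - f' (p + r *\<^sub>R X) X = f'' (p + r *\<^sub>R X + r' *\<^sub>R Y) X (s *\<^sub>R Y)"
      by auto
    moreover have "linear (f'' q Z)" for q Z
      using f2[of Z q] has_derivative_linear by blast
    ultimately have "f' (p + r *\<^sub>R X + s *\<^sub>R Y) X - f' (p + r *\<^sub>R X) X
        = s * f'' (p + r *\<^sub>R X + r' *\<^sub>R Y) X Y"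
      by (simp add: linear_cmul)
    with 1 r r' show ?thesis
      by (intro exI[of _ r] exI[of _ r']) auto
  qed
  have near: "\<exists>\<delta>>0. \<forall>s. 0 < s \<and> s < \<delta> \<longrightarrow> (\<exists>B. \<bar>B - f'' p X Y\<bar> < e \<and>
      f (p + s *\<^sub>R X + s *\<^sub>R Y) - f (p + s *\<^sub>R X) - f (p + s *\<^sub>R Y) + f p = s * s * B)"
    if "e > 0" for e X Y
  proof -
    from cont[of X Y] that obtain d where d: "d > 0"
      "\<And>q. dist q p < d \<Longrightarrow> dist (f'' q X Y) (f'' p X Y) < e"
      unfolding continuous_on_iff by blast
    \<comment> \<open>For s below this bound the whole parallelogram with sides sX and sY stays
      within distance d of p; the summand 1 covers X = Y = 0.\<close>
    define \<delta> where "\<delta> = d / (norm X + norm Y + 1)"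
    have pos: "norm X + norm Y + 1 > 0"
      using norm_ge_zero[of X] norm_ge_zero[of Y] by linarith
    show ?thesis
    proof (rule exI[of _ \<delta>], intro conjI allI impI)
      show "\<delta> > 0" using d pos by (simp add: \<delta>_def)
      fix s assume s: "0 < s \<and> s < \<delta>"
      from second_difference[of s X Y] s obtain r r' where r: "0 \<le> r" "r \<le> s" "0 \<le> r'" "r' \<le> s"
        and eq: "f (p + s *\<^sub>R X + s *\<^sub>R Y) - f (p + s *\<^sub>R X) - f (p + s *\<^sub>R Y) + f p
          = s * s * f'' (p + r *\<^sub>R X + r' *\<^sub>R Y) X Y" by blast
      have "norm (r *\<^sub>R X + r' *\<^sub>R Y) \<le> r * norm X + r' * norm Y"
        using norm_triangle_ineq[of "r *\<^sub>R X" "r' *\<^sub>R Y"] r by simp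
      also have "\<dots> \<le> s * norm X + s * norm Y"
        using r by (intro add_mono mult_right_mono) auto
      also have "\<dots> < s * (norm X + norm Y + 1)"
        using s by (simp add: algebra_simps)
      also have "\<dots> < d"
        using s pos by (simp add: \<delta>_def field_simps)
      finally have "dist (p + r *\<^sub>R X + r' *\<^sub>R Y) p < d"
        by (simp add: dist_norm add.assoc)
      from d(2)[OF this] eq show "\<exists>B. \<bar>B - f'' p X Y\<bar> < e \<and>
          f (p + s *\<^sub>R X + s *\<^sub>R Y) - f (p + s *\<^sub>R X) - f (p + s *\<^sub>R Y) + f p = s * s * B"
        by (auto simp: dist_real_def)
    qed
  qed
  have "\<bar>f'' p X Y - f'' p Y X\<bar> \<le> e + e" if "e > 0" for e
  proof -
    from near[OF that, of X Y] obtain d1 where d1: "d1 > 0" "\<And>s. 0 < s \<Longrightarrow> s < d1 \<Longrightarrow> \<exists>B. \<bar>B - f'' p X Y\<bar> < e \<and>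
      f (p + s *\<^sub>R X + s *\<^sub>R Y) - f (p + s *\<^sub>R X) - f (p + s *\<^sub>R Y) + f p = s * s * B" by auto
    from near[OF that, of Y X] obtain d2 where d2: "d2 > 0" "\<And>s. 0 < s \<Longrightarrow> s < d2 \<Longrightarrow> \<exists>B. \<bar>B - f'' p Y X\<bar> < e \<and>
      f (p + s *\<^sub>R Y + s *\<^sub>R X) - f (p + s *\<^sub>R Y) - f (p + s *\<^sub>R X) + f p = s * s * B" by auto
    define s where "s = min d1 d2 / 2"
    have s: "0 < s" "s < d1" "s < d2" using d1 d2 by (auto simp: s_def)
    from d1(2)[OF s(1,2)] d2(2)[OF s(1,3)] obtain B C where
      B: "\<bar>B - f'' p X Y\<bar> < e" "f (p + s *\<^sub>R X + s *\<^sub>R Y) - f (p + s *\<^sub>R X) - f (p + s *\<^sub>R Y) + f p = s * s * B" and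
      C: "\<bar>C - f'' p Y X\<bar> < e" "f (p + s *\<^sub>R Y + s *\<^sub>R X) - f (p + s *\<^sub>R Y) - f (p + s *\<^sub>R X) + f p = s * s * C"
      by blast
    have eq: "p + s *\<^sub>R Y + s *\<^sub>R X = p + s *\<^sub>R X + s *\<^sub>R Y"
      by (simp add: algebra_simps)
    have "s * s * B = f (p + s *\<^sub>R X + s *\<^sub>R Y) - f (p + s *\<^sub>R X) - f (p + s *\<^sub>R Y) + f p"
      by (rule B(2)[symmetric])
    also have "\<dots> = f (p + s *\<^sub>R Y + s *\<^sub>R X) - f (p + s *\<^sub>R Y) - f (p + s *\<^sub>R X) + f p"
      by (simp only: eq)
    also have "\<dots> = s * s * C" by (rule C(2))
    finally have "s * s * B = s * s * C" .
    then have "B = C" using s by simp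
    with B C show ?thesis by linarith
  qed
  \<comment> \<open>If the values differed, two thirds of their distance would bound that
    distance.\<close>
  from this[of "\<bar>f'' p X Y - f'' p Y X\<bar> / 3"] show ?thesis
    by (cases "f'' p X Y = f'' p Y X") auto
qed

section \<open>Calculus of k-fold continuously differentiable maps\<close>

lemma Ck_on_cong:
  assumes "open U" "\<And>x. x \<in> U \<Longrightarrow> f x = g x" "Ck_on k U f"
  shows "Ck_on k U g"
  using assms(2,3)
proof (induction k arbitrary: f g)
  case 0
  then show ?case by (simp cong: continuous_on_cong)
next
  case (Suc k)
  have 1: "f differentiable at x" if "x \<in> U" for x
    using Suc.prems that by simp
  have 2: "g differentiable at x" if "x \<in> U" for x
    using 1[OF that] \<open>open U\<close> Suc.prems(1) that
    by (meson differentiable_def has_derivative_transform_within_open)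
  have "frechet_derivative f (at x) v = frechet_derivative g (at x) v" if "x \<in> U" for x v
    using frechet_derivative_transform_within_open[OF 1[OF that] \<open>open U\<close> that] Suc.prems(1) by simp
  then have "Ck_on k U (\<lambda>x. frechet_derivative g (at x) v)" for v
    using Suc.IH[of "\<lambda>x. frechet_derivative f (at x) v" "\<lambda>x. frechet_derivative g (at x) v"] Suc.prems(2) by auto
  with 2 show ?case by simp
qed

lemma Ck_on_SucI:
  assumes "open U" "\<And>x. x \<in> U \<Longrightarrow> (f has_derivative f' x) (at x)" "\<And>v. Ck_on k U (\<lambda>x. f' x v)"
  shows "Ck_on (Suc k) U f"
proof -
  have "f' x v = frechet_derivative f (at x) v" if "x \<in> U" for x v
    using frechet_derivative_at[OF assms(2)[OF that]] by simp
  then have "Ck_on k U (\<lambda>x. frechet_derivative f (at x) v)" for v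
    by (rule Ck_on_cong[OF assms(1) _ assms(3)])
  with assms(2) show ?thesis
    by (auto simp: differentiable_def)
qed

lemma Ck_on_Suc_imp: "Ck_on (Suc k) U f \<Longrightarrow> Ck_on k U f"
proof (induction k arbitrary: f)
  case 0
  then show ?case
    by (auto intro!: continuous_at_imp_continuous_on differentiable_imp_continuous_within)
next
  case (Suc k)
  then show ?case by simp
qed

lemma Ck_on_const: "Ck_on k U (\<lambda>x. c)"
  by (induction k arbitrary: c) simp_all

lemma Ck_on_bounded_linear:
  assumes "open U" "bounded_linear f"
  shows "Ck_on k U f"
proof (cases k)
  case 0
  then show ?thesis
    using assms(2) by (simp add: linear_continuous_on)
next
  case (Suc j)
  have "Ck_on (Suc j) U f"
    by (rule Ck_on_SucI[OF assms(1) bounded_linear_imp_has_derivative[OF assms(2)] Ck_on_const])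
  then show ?thesis by (simp only: Suc)
qed

lemma Ck_on_add:
  assumes "open U" "Ck_on k U f" "Ck_on k U g"
  shows "Ck_on k U (\<lambda>x. f x + g x)"
  using assms(2,3)
proof (induction k arbitrary: f g)
  case 0
  then show ?case by (simp add: continuous_on_add)
next
  case (Suc k)
  have "((\<lambda>x. f x + g x) has_derivative
      (\<lambda>v. frechet_derivative f (at x) v + frechet_derivative g (at x) v)) (at x)" if "x \<in> U" for x
    using Suc.prems that by (intro has_derivative_add) (auto simp flip: frechet_derivative_works)
  then show ?case
    using Suc.prems Suc.IH by (intro Ck_on_SucI[OF assms(1)]) auto
qed

lemma Ck_on_mult:
  fixes f g :: "'a::euclidean_space \<Rightarrow> real"
  assumes "open U" "Ck_on k U f" "Ck_on k U g"
  shows "Ck_on k U (\<lambda>x. f x * g x)"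
  using assms(2,3)
proof (induction k arbitrary: f g)
  case 0
  then show ?case by (simp add: continuous_on_mult)
next
  case (Suc k)
  have "((\<lambda>x. f x * g x) has_derivative
      (\<lambda>v. f x * frechet_derivative g (at x) v + frechet_derivative f (at x) v * g x)) (at x)" if "x \<in> U" for x
    using Suc.prems that by (intro has_derivative_mult) (auto simp flip: frechet_derivative_works)
  moreover have "Ck_on k U f" "Ck_on k U g"
    using Suc.prems Ck_on_Suc_imp by blast+
  ultimately show ?case
    using Suc.prems Suc.IH
    by (intro Ck_on_SucI[OF assms(1), where f' = "\<lambda>x v. f x * frechet_derivative g (at x) v + frechet_derivative f (at x) v * g x"]
        Ck_on_add[OF assms(1)]) auto
qed

lemma smooth_on_differentiable:
  assumes "smooth_on U f" "x \<in> U"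
  shows "f differentiable (at x)"
proof -
  have "Ck_on (Suc 0) U f" using assms(1) by (simp only: smooth_on_def)
  with assms(2) show ?thesis by simp
qed

lemma smooth_on_frechet_derivative:
  assumes "smooth_on U f"
  shows "smooth_on U (\<lambda>x. frechet_derivative f (at x) v)"
  unfolding smooth_on_def
proof
  fix k
  have "Ck_on (Suc k) U f" using assms by (simp only: smooth_on_def)
  then show "Ck_on k U (\<lambda>x. frechet_derivative f (at x) v)" by simp
qed

lemma smooth_on_has_derivative:
  "smooth_on U f \<Longrightarrow> x \<in> U \<Longrightarrow> (f has_derivative frechet_derivative f (at x)) (at x)"
  using smooth_on_differentiable frechet_derivative_works by blast

lemma smooth_on_continuous: "smooth_on U f \<Longrightarrow> continuous_on U f"
  unfolding smooth_on_def by (metis Ck_on.simps(1))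

lemma smooth_on_bounded_linear: "open U \<Longrightarrow> bounded_linear f \<Longrightarrow> smooth_on U f"
  by (simp add: smooth_on_def Ck_on_bounded_linear)

section \<open>Second derivatives of smooth maps\<close>

definition second_derivative ::
    "('a::euclidean_space \<Rightarrow> 'b::euclidean_space) \<Rightarrow> 'a \<Rightarrow> 'a \<Rightarrow> 'a \<Rightarrow> 'b" where
  "second_derivative f p X Y = frechet_derivative (\<lambda>q. frechet_derivative f (at q) X) (at p) Y"

lemma smooth_on_has_second_derivative:
  "smooth_on U f \<Longrightarrow> p \<in> U \<Longrightarrow>
    ((\<lambda>q. frechet_derivative f (at q) X) has_derivative second_derivative f p X) (at p)"
  unfolding second_derivative_def
  by (intro smooth_on_has_derivative[OF smooth_on_frechet_derivative])

lemma second_derivative_symmetric: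
  assumes "smooth_on UNIV f"
  shows "second_derivative f p X Y = second_derivative f p Y X"
proof (rule euclidean_eqI)
  fix b :: 'b assume "b \<in> Basis"
  show "second_derivative f p X Y \<bullet> b = second_derivative f p Y X \<bullet> b"
  proof (rule symmetric_second_frechet[where f = "\<lambda>q. f q \<bullet> b" and f' = "\<lambda>q Z. frechet_derivative f (at q) Z \<bullet> b"])
    fix q
    show "((\<lambda>q. f q \<bullet> b) has_derivative (\<lambda>Z. frechet_derivative f (at q) Z \<bullet> b)) (at q)"
      by (intro has_derivative_inner_left smooth_on_has_derivative[OF assms] UNIV_I)
  next
    fix q Z
    show "((\<lambda>q. frechet_derivative f (at q) Z \<bullet> b) has_derivative (\<lambda>W. second_derivative f q Z W \<bullet> b)) (at q)"
      by (intro has_derivative_inner_left smooth_on_has_second_derivative[OF assms] UNIV_I)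
  next
    fix Z W
    have "smooth_on UNIV (\<lambda>q. second_derivative f q Z W)"
      unfolding second_derivative_def by (intro smooth_on_frechet_derivative assms)
    then show "continuous_on UNIV (\<lambda>q. second_derivative f q Z W \<bullet> b)"
      by (intro continuous_intros smooth_on_continuous)
  qed
qed

lemma linear_second_derivative:
  assumes "smooth_on UNIV f"
  shows "linear (second_derivative f p X)"
  by (rule has_derivative_linear[OF smooth_on_has_second_derivative[OF assms UNIV_I]])

section \<open>Conformal maps whose factor depends on time only\<close>

abbreviation xc :: "real \<times> 'a \<times> real \<Rightarrow> 'a" where "xc p \<equiv> fst (snd p)"
abbreviation vc :: "real \<times> 'a \<times> real \<Rightarrow> real" where "vc p \<equiv> snd (snd p)"

section \<open>The Cahen-Wallach metric and its Levi-Civita connection\<close>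

lemma inner_symmetric_matrix:
  fixes S :: "real^'n^'n"
  assumes "transpose S = S"
  shows "x \<bullet> (S *v y) = y \<bullet> (S *v x)"
  by (metis assms dot_lmul_matrix inner_commute vector_transpose_matrix)

lemma cw_metric_eq:
  "cw_metric S p X Y = vc X * fst Y + fst X * vc Y + (xc p \<bullet> (S *v xc p)) * (fst X * fst Y) + xc X \<bullet> xc Y"
  by (simp add: cw_metric_def case_prod_unfold)

lemma cw_metric_commute: "cw_metric S p X Y = cw_metric S p Y X"
  by (simp add: cw_metric_eq inner_commute)

lemma bilinear_cw_metric: "bilinear (cw_metric S p)"
  by (auto simp: bilinear_def cw_metric_eq algebra_simps intro!: linearI)

lemma cw_metric_add_left: "cw_metric S p (X + X') Y = cw_metric S p X Y + cw_metric S p X' Y"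
  and cw_metric_diff_left: "cw_metric S p (X - X') Y = cw_metric S p X Y - cw_metric S p X' Y"
  by (simp_all add: cw_metric_eq algebra_simps)

lemma cw_metric_nondegenerate:
  assumes "\<And>Y. cw_metric S p X Y = 0"
  shows "X = 0"
proof -
  have 1: "fst X = 0"
    using assms[of "(0,0,1)"] by (simp add: cw_metric_eq)
  have 2: "xc X = 0"
    using assms[of "(0,xc X,0)"] by (simp add: cw_metric_eq)
  have "vc X = 0"
    using assms[of "(1,0,0)"] 1 2 by (simp add: cw_metric_eq)
  with 1 2 show ?thesis by (simp add: prod_eq_iff)
qed

text \<open>Product rule. Only the coefficient of dt^2 depends on the base point; it produces the
  last summand, where the symmetry of S merges two equal terms.\<close>

lemma cw_metric_has_derivative:
  assumes "transpose S = S"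
    and \<phi>: "(\<phi> has_derivative \<phi>') (at p)"
    and P: "(P has_derivative P') (at p)" and R: "(R has_derivative R') (at p)"
  shows "((\<lambda>q. cw_metric S (\<phi> q) (P q) (R q)) has_derivative
    (\<lambda>Z. cw_metric S (\<phi> p) (P' Z) (R p) + cw_metric S (\<phi> p) (P p) (R' Z)
       + 2 * (xc (\<phi> p) \<bullet> (S *v xc (\<phi>' Z))) * (fst (P p) * fst (R p)))) (at p)"
proof -
  have S: "((\<lambda>q. S *v xc (\<phi> q)) has_derivative (\<lambda>Z. S *v xc (\<phi>' Z))) (at p)"
    by (intro bounded_linear.has_derivative[OF matrix_vector_mul_bounded_linear] has_derivative_fst has_derivative_snd \<phi>)
  show ?thesis
    unfolding cw_metric_eq
    apply (rule derivative_eq_intros S \<phi> P R refl)+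
    apply (simp add: fun_eq_iff algebra_simps inner_symmetric_matrix[OF assms(1), of "xc (\<phi>' _)"])
    done
qed

text \<open>The Levi-Civita connection of g_S on constant fields in closed form;
  \<open>cw_christoffel_koszul\<close> is the Koszul formula divided by 2.\<close>

definition cw_christoffel ::
    "real^'n^'n \<Rightarrow> real \<times> (real^'n) \<times> real \<Rightarrow> real \<times> (real^'n) \<times> real \<Rightarrow> real \<times> (real^'n) \<times> real \<Rightarrow> real \<times> (real^'n) \<times> real" where
  "cw_christoffel S p X Y =
    (0, - (fst X * fst Y) *\<^sub>R (S *v xc p), (xc p \<bullet> (S *v xc X)) * fst Y + (xc p \<bullet> (S *v xc Y)) * fst X)"

text \<open>The Levi-Civita connection of e^(2f) g_S at a point where df = k dt. The usual
  correction term is df(X) Y + df(Y) X - g(X,Y) grad f, and the gradient of t is the vector (0, 0,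
  1).\<close>

definition conformal_christoffel ::
    "real^'n^'n \<Rightarrow> real \<Rightarrow> real \<times> (real^'n) \<times> real \<Rightarrow> real \<times> (real^'n) \<times> real \<Rightarrow> real \<times> (real^'n) \<times> real \<Rightarrow> real \<times> (real^'n) \<times> real" where
  "conformal_christoffel S k p X Y = cw_christoffel S p X Y
    + k *\<^sub>R (fst X *\<^sub>R Y + fst Y *\<^sub>R X - cw_metric S p X Y *\<^sub>R (0, 0, 1))"

lemma cw_christoffel_koszul:
  assumes "transpose S = S"
  shows "cw_metric S p (cw_christoffel S p X Y) Z =
    (xc p \<bullet> (S *v xc X)) * (fst Y * fst Z) + (xc p \<bullet> (S *v xc Y)) * (fst X * fst Z)
    - (xc p \<bullet> (S *v xc Z)) * (fst X * fst Y)"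
  by (simp add: cw_metric_eq cw_christoffel_def algebra_simps inner_commute[of "S *v xc p"]
      inner_symmetric_matrix[OF assms, of "xc Z" "xc p"])

lemma conformal_christoffel_koszul:
  assumes "transpose S = S"
  shows "cw_metric S p (conformal_christoffel S k p X Y) Z =
    (xc p \<bullet> (S *v xc X)) * (fst Y * fst Z) + (xc p \<bullet> (S *v xc Y)) * (fst X * fst Z)
    - (xc p \<bullet> (S *v xc Z)) * (fst X * fst Y)
    + k * (fst X * cw_metric S p Y Z + fst Y * cw_metric S p X Z - fst Z * cw_metric S p X Y)"
  unfolding conformal_christoffel_def cw_metric_add_left cw_christoffel_koszul[OF assms]
  by (simp add: cw_metric_eq algebra_simps)

section \<open>The Hessian equation of a conformal map whose factor has differential k dt\<close>

locale cw_conformal =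
  fixes S :: "real^'n^'n" and \<phi> :: "real \<times> (real^'n) \<times> real \<Rightarrow> real \<times> (real^'n) \<times> real"
    and f k :: "real \<times> (real^'n) \<times> real \<Rightarrow> real"
  assumes S_sym: "transpose S = S"
    and smooth: "smooth_on UNIV \<phi>"
    and surj_derivative: "surj (frechet_derivative \<phi> (at p))"
    and pullback: "cw_metric S (\<phi> p) (frechet_derivative \<phi> (at p) X) (frechet_derivative \<phi> (at p) Y)
        = exp (2 * f p) * cw_metric S p X Y"
    and smooth_factor: "smooth_on UNIV f"
    and factor_derivative: "(f has_derivative (\<lambda>X. fst X *\<^sub>R k p)) (at p)"
begin

abbreviation "d p X \<equiv> frechet_derivative \<phi> (at p) X"
abbreviation "dd p X Y \<equiv> second_derivative \<phi> p X Y"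

lemma has_d: "(\<phi> has_derivative d p) (at p)"
  by (rule smooth_on_has_derivative[OF smooth UNIV_I])

lemma has_dd: "((\<lambda>q. d q X) has_derivative dd p X) (at p)"
  by (rule smooth_on_has_second_derivative[OF smooth UNIV_I])

lemma linear_d: "linear (d p)"
  using has_derivative_linear[OF has_d] .

lemma dd_commute: "dd p X Y = dd p Y X"
  by (rule second_derivative_symmetric[OF smooth])

lemma derivative_pullback:
  "cw_metric S (\<phi> p) (dd p X Z) (d p Y) + cw_metric S (\<phi> p) (d p X) (dd p Y Z)
     + 2 * (xc (\<phi> p) \<bullet> (S *v xc (d p Z))) * (fst (d p X) * fst (d p Y))
   = exp (2 * f p) * (2 * k p * fst Z * cw_metric S p X Y + 2 * (xc p \<bullet> (S *v xc Z)) * (fst X * fst Y))"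
proof -
  have 1: "((\<lambda>q. cw_metric S (\<phi> q) (d q X) (d q Y)) has_derivative
      (\<lambda>Z. cw_metric S (\<phi> p) (dd p X Z) (d p Y) + cw_metric S (\<phi> p) (d p X) (dd p Y Z)
     + 2 * (xc (\<phi> p) \<bullet> (S *v xc (d p Z))) * (fst (d p X) * fst (d p Y)))) (at p)"
    by (rule cw_metric_has_derivative[OF S_sym has_d has_dd has_dd])
  have "((\<lambda>q. exp (2 * f q)) has_derivative (\<lambda>Z. 2 * (fst Z * k p) * exp (2 * f p))) (at p)"
    by (rule derivative_eq_intros factor_derivative refl | simp)+
  moreover have "((\<lambda>q. cw_metric S q X Y) has_derivative
      (\<lambda>Z. 2 * (xc p \<bullet> (S *v xc Z)) * (fst X * fst Y))) (at p)"
    using cw_metric_has_derivative[OF S_sym has_derivative_ident has_derivative_const has_derivative_const, of X Y p]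
    by (simp add: cw_metric_eq)
  ultimately have "((\<lambda>q. exp (2 * f q) * cw_metric S q X Y) has_derivative
      (\<lambda>Z. exp (2 * f p) * (2 * (xc p \<bullet> (S *v xc Z)) * (fst X * fst Y))
        + 2 * (fst Z * k p) * exp (2 * f p) * cw_metric S p X Y)) (at p)"
    by (rule has_derivative_mult)
  from has_derivative_unique[OF 1[unfolded pullback] this]
  have "cw_metric S (\<phi> p) (dd p X Z) (d p Y) + cw_metric S (\<phi> p) (d p X) (dd p Y Z)
     + 2 * (xc (\<phi> p) \<bullet> (S *v xc (d p Z))) * (fst (d p X) * fst (d p Y))
    = exp (2 * f p) * (2 * (xc p \<bullet> (S *v xc Z)) * (fst X * fst Y))
        + 2 * (fst Z * k p) * exp (2 * f p) * cw_metric S p X Y"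
    by (rule fun_cong)
  then show ?thesis by (simp add: algebra_simps)
qed

text \<open>The transformation law of Christoffel symbols: the pullback of g_S is e^(2f) g_S, so
  \<phi> carries the connection of the latter to that of g_S. Since the differential is onto, it is
  enough to test against the vectors \<open>d p Z\<close>.\<close>

lemma hessian:
  "dd p X Y + cw_christoffel S (\<phi> p) (d p X) (d p Y) = d p (conformal_christoffel S (k p) p X Y)"
proof -
  let ?G = "cw_metric S (\<phi> p)"
  have "?G (dd p X Y + cw_christoffel S (\<phi> p) (d p X) (d p Y) - d p (conformal_christoffel S (k p) p X Y)) (d p Z) = 0" for Z
  proof -
    \<comment> \<open>By symmetry of second derivatives, four of the six second-order terms cancel
      in the Koszul combination below.\<close>
    have a: "?G (dd p X Y) (d p Z) = ?G (dd p Y X) (d p Z)" "?G (d p Y) (dd p Z X) = ?G (dd p X Z) (d p Y)"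
      "?G (d p X) (dd p Z Y) = ?G (d p X) (dd p Y Z)"
      by (simp_all add: dd_commute cw_metric_commute)
    \<comment> \<open>Koszul's combination: the derivative of the pullback identity for (Y,Z) along
      X, plus that for (X,Z) along Y, minus that for (X,Y) along Z.\<close>
    have "2 * ?G (dd p X Y) (d p Z) + 2 * ?G (cw_christoffel S (\<phi> p) (d p X) (d p Y)) (d p Z)
        = 2 * (exp (2 * f p) * cw_metric S p (conformal_christoffel S (k p) p X Y) Z)"
      using derivative_pullback[of p Y X Z] derivative_pullback[of p X Y Z] derivative_pullback[of p X Z Y] a
      unfolding cw_christoffel_koszul[OF S_sym] conformal_christoffel_koszul[OF S_sym]
      by (simp add: algebra_simps)
    then show ?thesis
      unfolding cw_metric_diff_left cw_metric_add_left by (simp add: pullback)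
  qed
  then have "?G (dd p X Y + cw_christoffel S (\<phi> p) (d p X) (d p Y) - d p (conformal_christoffel S (k p) p X Y)) W = 0" for W
    using surj_derivative[of p] by (metis surjD)
  from cw_metric_nondegenerate[OF this] show ?thesis by simp
qed

lemma hessian_t: "fst (dd p X Y) = fst (d p (conformal_christoffel S (k p) p X Y))"
  using arg_cong[OF hessian, of fst p X Y] by (simp add: cw_christoffel_def)

lemma hessian_x: "xc (dd p X Y) = (fst (d p X) * fst (d p Y)) *\<^sub>R (S *v xc (\<phi> p)) + xc (d p (conformal_christoffel S (k p) p X Y))"
  using arg_cong[OF hessian, of xc p X Y] by (simp add: cw_christoffel_def algebra_simps)

lemma d_decompose: "d p X = fst X *\<^sub>R d p (1,0,0) + d p (0, xc X, 0) + vc X *\<^sub>R d p (0,0,1)"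
proof -
  have "X = fst X *\<^sub>R (1,0,0) + (0, xc X, 0) + vc X *\<^sub>R (0,0,1)"
    by (simp add: prod_eq_iff)
  then have "d p X = d p (fst X *\<^sub>R (1,0,0) + (0, xc X, 0) + vc X *\<^sub>R (0,0,1))" by simp
  also have "\<dots> = fst X *\<^sub>R d p (1,0,0) + d p (0, xc X, 0) + vc X *\<^sub>R d p (0,0,1)"
    unfolding linear_add[OF linear_d] linear_cmul[OF linear_d] ..
  finally show ?thesis .
qed

end

text \<open>The differential vanishes along the slices t = const, so g depends on t alone; then so
  does h, because it is the t-derivative of g.\<close>

lemma slice_derivative:
  fixes g :: "real \<times> 'a::real_normed_vector \<Rightarrow> 'b::real_normed_vector"
  assumes g: "\<And>p. (g has_derivative (\<lambda>Y. fst Y *\<^sub>R h p)) (at p)"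
  shows "g p = g (fst p, 0)" and "h p = h (fst p, 0)"
    and "((\<lambda>t. g (t, 0)) has_vector_derivative h (t, 0)) (at t)"
proof -
  have const: "g (t, y) = g (t, 0)" for t y
  proof -
    have "((\<lambda>y. g (t, y)) has_derivative (\<lambda>z. fst (0::real, z) *\<^sub>R h (t, y))) (at y)" for y
      by (rule has_derivative_compose[OF _ g]) (auto intro!: derivative_eq_intros)
    then have "((\<lambda>y. g (t, y)) has_derivative (\<lambda>z. 0)) (at y)" for y
      by simp
    then show ?thesis
      using has_derivative_zero_constant[of UNIV "\<lambda>y. g (t, y)"] by auto
  qed
  have deriv: "((\<lambda>t. g (t, y)) has_vector_derivative h (t, y)) (at t)" for t y
  proof -
    have "((\<lambda>t. g (t, y)) has_derivative (\<lambda>s. fst (s, 0::'a) *\<^sub>R h (t, y))) (at t)"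
      by (rule has_derivative_compose[OF _ g]) (auto intro!: derivative_eq_intros)
    then show ?thesis by (simp add: has_vector_derivative_def)
  qed
  show "g p = g (fst p, 0)"
    using const[of "fst p" "snd p"] by simp
  have "((\<lambda>t. g (t, 0)) has_vector_derivative h (t, y)) (at t)" for t y
    using deriv[of y t] by (simp only: const[of _ y])
  then show "h p = h (fst p, 0)"
    using vector_derivative_unique_at[OF _ deriv[of 0 "fst p"]] by (metis prod.collapse)
  show "((\<lambda>t. g (t, 0)) has_vector_derivative h (t, 0)) (at t)"
    by (rule deriv)
qed

section \<open>Traces and similarity of matrices\<close>

lemma matrix_mult_mat: "A ** mat q = q *\<^sub>R A" "mat q ** A = q *\<^sub>R A"
  for A :: "real^'n^'n"
  by (simp_all add: matrix_matrix_mult_def mat_def vec_eq_iff if_distrib if_distribR sum.delta' mult.commute cong: if_cong)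

lemma matrix_add_right_distrib: "(A + B) ** C = A ** C + B ** C"
  and matrix_diff_right_distrib: "(A - B) ** C = A ** C - B ** C"
  and matrix_diff_left_distrib: "C ** (A - B) = C ** A - C ** B"
  for A B C :: "real^'n^'n"
  by (simp_all add: matrix_matrix_mult_def vec_eq_iff algebra_simps sum.distrib sum_subtractf)

lemma trace_scaleR: "trace (q *\<^sub>R A) = q * trace A" for A :: "real^'n^'n"
  by (simp add: trace_def sum_distrib_left)

text \<open>
  The hypothesis says that \<open>r S\<close> is similar to \<open>S + q I\<close>; comparing the traces of the squares of the
  trace-free parts gives \<open>r\<^sup>2 = 1\<close>.
\<close>

lemma similar_to_affine_multiple:
  fixes S M :: "real^'n^'n"
  assumes sym: "transpose S = S" and nonscalar: "\<nexists>c. S = mat c"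
    and "invertible M" "r \<ge> 0"
    and eq: "\<And>x. r *\<^sub>R (S *v (M *v x)) = M *v (S *v x) + q *\<^sub>R (M *v x)"
  shows "r = 1"
proof -
  define n where "n = real CARD('n)"
  have n: "n > 0" by (simp add: n_def)
  define c where "c = trace S / n"
  from \<open>invertible M\<close> obtain M' where M': "M ** M' = mat 1" "M' ** M = mat 1"
    by (auto simp: invertible_def)
  define P where "P = M ** S ** M'"
  \<comment> \<open>The hypothesis at \<open>M' *v x\<close>, where P is the conjugate of S by
    M.\<close>
  have rS: "r *\<^sub>R S = P + mat q"
  proof (rule matrix_eq[THEN iffD2], rule allI)
    fix x
    have "(r *\<^sub>R S) *v x = r *\<^sub>R (S *v (M *v (M' *v x)))"
      by (simp add: scaleR_matrix_vector_assoc matrix_vector_mul_assoc M')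
    also have "\<dots> = M *v (S *v (M' *v x)) + q *\<^sub>R (M *v (M' *v x))"
      by (rule eq)
    also have "\<dots> = (P + mat q) *v x"
      by (simp add: P_def matrix_vector_mul_assoc M' matrix_vector_mult_add_rdistrib matrix_mul_assoc)
        (metis matrix_mult_mat(1) matrix_mul_lid matrix_vector_mul_lid scaleR_matrix_vector_assoc)
    finally show "(r *\<^sub>R S) *v x = (P + mat q) *v x" .
  qed
  have trP: "trace P = trace S"
    unfolding P_def by (metis M'(2) matrix_mul_assoc matrix_mul_rid trace_mul_sym)
  have "P ** P = M ** S ** (M' ** M) ** S ** M'"
    unfolding P_def by (simp only: matrix_mul_assoc)
  then have "P ** P = M ** (S ** S) ** M'"
    by (simp add: M' matrix_mul_assoc)
  then have trPP: "trace (P ** P) = trace (S ** S)"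
    by (metis M'(2) matrix_mul_assoc matrix_mul_rid trace_mul_sym)
  have trmat: "trace (mat a :: real^'n^'n) = n * a" for a
    by (simp add: trace_def mat_def n_def)
  have 1: "r * trace S = trace S + n * q"
    using arg_cong[OF rS, of trace] by (simp add: trace_scaleR trace_add trP trmat)
  have "(r *\<^sub>R S) ** (r *\<^sub>R S) = (P + mat q) ** (P + mat q)"
    by (simp only: rS)
  also have "\<dots> = P ** P + (2 * q) *\<^sub>R P + mat (q * q)"
    by (simp add: matrix_add_ldistrib matrix_add_right_distrib matrix_mult_mat)
      (simp add: mat_def vec_eq_iff algebra_simps)
  finally have "(r * r) *\<^sub>R (S ** S) = P ** P + (2 * q) *\<^sub>R P + mat (q * q)"
    by (simp add: matrix_matrix_mult_def vec_eq_iff sum_distrib_left algebra_simps)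
  from arg_cong[OF this, of trace]
  have 2: "r * r * trace (S ** S) = trace (S ** S) + 2 * q * trace S + n * (q * q)"
    by (simp add: trace_scaleR trace_add trP trPP trmat)
  define T where "T = S - mat c"
  have "transpose T = T"
    using sym by (simp add: T_def transpose_def vec_eq_iff mat_def)
  have "T ** T = S ** S - (2 * c) *\<^sub>R S + mat (c * c)"
    by (simp add: T_def matrix_diff_left_distrib matrix_diff_right_distrib matrix_mult_mat)
       (simp add: mat_def vec_eq_iff algebra_simps)
  from arg_cong[OF this, of trace]
  have 3: "trace (T ** T) = trace (S ** S) - 2 * c * trace S + n * (c * c)"
    by (simp add: trace_scaleR trace_add trace_sub trmat)
  have "T \<noteq> 0"
    using nonscalar by (auto simp: T_def)
  \<comment> \<open>As T is symmetric, this trace is the sum of the squares of its entries.\<close>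
  have "trace (T ** T) = (\<Sum>i\<in>UNIV. \<Sum>j\<in>UNIV. T $ i $ j * T $ j $ i)"
    by (simp add: trace_def matrix_matrix_mult_def)
  also have "\<dots> = (\<Sum>i\<in>UNIV. T $ i \<bullet> T $ i)"
    unfolding inner_vec_def using \<open>transpose T = T\<close>
    by (intro sum.cong refl) (metis inner_real_def transpose_def vec_lambda_beta)
  also have "\<dots> = T \<bullet> T"
    by (simp add: inner_vec_def)
  finally have 4: "trace (T ** T) > 0"
    using \<open>T \<noteq> 0\<close> by simp
  \<comment> \<open>The trace identity determines q: the shift only adjusts the scalar part and
    drops out once S is replaced by its trace-free part T.\<close>
  have "trace S = n * c" using n by (simp add: c_def)
  with 1 have "n * q = n * ((r - 1) * c)" by (simp add: algebra_simps)
  with n have q: "q = (r - 1) * c" by simp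
  have "(r * r - 1) * trace (T ** T) = 0"
    using 2 unfolding 3 q \<open>trace S = n * c\<close> by (simp add: algebra_simps)
  with 4 have "r * r = 1" by simp
  with \<open>r \<ge> 0\<close> show ?thesis
    by (auto simp: square_eq_1_iff)
qed

section \<open>The time component\<close>

context cw_conformal
begin

text \<open>
  The time component of a homothety has vanishing Hessian.  Such a function is affine in \<open>t\<close> and
  independent of \<open>x\<close> and \<open>v\<close>, because \<open>S\<close> is invertible.
\<close>

lemma homothety_time:
  assumes "det S \<noteq> 0" and k: "\<And>p. k p = 0"
  obtains \<alpha> \<beta> where "\<And>p. fst (\<phi> p) = \<alpha> * fst p + \<beta>" "\<And>p X. fst (d p X) = \<alpha> * fst X"
proof -
  have S: "surj ((*v) S)"
    using assms(1) by (metis invertible_det_nz invertible_right_inverse matrix_right_invertible_surjective)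
  have conf: "conformal_christoffel S (k p) p X Y = cw_christoffel S p X Y" for p X Y
    by (simp add: conformal_christoffel_def k)
  have has: "((\<lambda>q. fst (d q X)) has_derivative (\<lambda>Y. fst (d p (cw_christoffel S p X Y)))) (at p)" for p X
    using has_derivative_fst[OF has_dd[of X p]] unfolding hessian_t conf .
  have const: "\<exists>c. \<forall>p. fst (d p X) = c" if "\<And>p Y. fst (d p (cw_christoffel S p X Y)) = 0" for X
    using has_derivative_zero_constant[of UNIV "\<lambda>q. fst (d q X)"] has[of X] that by auto
  have "cw_christoffel S p (0,0,1) Y = 0" for p Y
    by (simp add: cw_christoffel_def zero_prod_def)
  then obtain a where a: "fst (d p (0,0,1)) = a" for p
    using const[of "(0,0,1)"] linear_0[OF linear_d] by auto
  have dv: "fst (d p (0,0,b)) = b * a" for p b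
    using arg_cong[OF d_decompose[of p "(0,0,b)"], of fst] linear_0[OF linear_d] a by (simp add: zero_prod_def)
  \<comment> \<open>The t-component of \<open>d p (0,\<xi>,0)\<close> has differential
    \<open>(x \<bullet> S \<xi>) * a\<close> times dt. By \<open>slice_derivative\<close> this
    coefficient cannot vary with x, and it vanishes at x = 0; a point with x =
    \<open>S *v \<xi>\<close> = 1 then forces a = 0.\<close>
  have "a = 0"
  proof -
    have chr: "fst (d p (cw_christoffel S p (0,\<xi>,0) Y)) = fst Y *\<^sub>R ((xc p \<bullet> (S *v \<xi>)) * a)" for p \<xi> Y
      by (simp add: cw_christoffel_def dv)
    have zero: "(xc p \<bullet> (S *v \<xi>)) * a = 0" for p \<xi>
      using slice_derivative(2)[OF has[of "(0,\<xi>,0)", unfolded chr], of p] by simp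
    obtain \<xi> where \<xi>: "S *v \<xi> = 1" using S by (metis surjD)
    have "(1::real^'n) \<bullet> 1 \<noteq> 0" by simp
    with zero[of "(0,1,0)" \<xi>] \<xi> show ?thesis by simp
  qed
  have "fst (d p (cw_christoffel S p (0,\<xi>,0) Y)) = 0" for p \<xi> Y
    by (simp add: cw_christoffel_def dv \<open>a = 0\<close>)
  then have "\<exists>c. \<forall>p. fst (d p (0,\<xi>,0)) = c" for \<xi>
    by (intro const)
  then obtain b where b: "fst (d p (0,\<xi>,0)) = b \<xi>" for p \<xi>
    by metis
  \<comment> \<open>The same argument for the direction (1,0,0): the coefficient is b at - S x,
    which must not depend on x, while - S x takes every value \<xi>.\<close>
  have b0: "b \<xi> = 0" for \<xi>
  proof -
    have chr: "fst (d p (cw_christoffel S p (1,0,0) Y)) = fst Y *\<^sub>R fst (d p (0, - (S *v xc p), 0))" for p Y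
    proof -
      have "cw_christoffel S p (1,0,0) Y = fst Y *\<^sub>R (0, - (S *v xc p), 0) + (xc p \<bullet> (S *v xc Y)) *\<^sub>R (0,0,1)"
        by (simp add: cw_christoffel_def)
      then show ?thesis
        by (simp add: linear_add[OF linear_d] linear_cmul[OF linear_d] a \<open>a = 0\<close> del: scaleR_Pair)
    qed
    obtain x where x: "S *v x = - \<xi>" using S by (metis surjD)
    from slice_derivative(2)[OF has[of "(1,0,0)", unfolded chr], of "(0,x,0)"]
    have "b \<xi> = b 0" by (simp add: b x)
    also have "b 0 = 0"
      using b[of 0 0] linear_0[OF linear_d, of 0] by (simp add: zero_prod_def)
    finally show ?thesis .
  qed
  have "\<exists>c. \<forall>p. fst (d p (1,0,0)) = c"
  proof (rule const)
    fix p Y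
    show "fst (d p (cw_christoffel S p (1,0,0) Y)) = 0"
      using arg_cong[OF d_decompose[of p "cw_christoffel S p (1,0,0) Y"], of fst]
      by (simp add: a b b0 \<open>a = 0\<close>) (simp add: cw_christoffel_def)
  qed
  then obtain \<alpha> where \<alpha>: "fst (d p (1,0,0)) = \<alpha>" for p by blast
  have d: "fst (d p X) = \<alpha> * fst X" for p X
    using arg_cong[OF d_decompose[of p X], of fst] by (simp add: a b b0 \<open>a = 0\<close> \<alpha> mult.commute)
  have "((\<lambda>q. fst (\<phi> q) - \<alpha> * fst q) has_derivative (\<lambda>X. 0)) (at p)" for p
    by (rule derivative_eq_intros has_d refl)+ (simp add: d)
  then obtain \<beta> where "\<forall>p. fst (\<phi> p) - \<alpha> * fst p = \<beta>"
    using has_derivative_zero_constant[of UNIV "\<lambda>q. fst (\<phi> q) - \<alpha> * fst q"] by auto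
  with d show ?thesis
    by (intro that[of \<alpha> \<beta>]) (auto simp: algebra_simps)
qed

end

section \<open>Conformal maps preserving the foliation by time slices\<close>

locale cw_conformal_time = cw_conformal S \<phi> f k
  for S :: "real^'n^'n" and \<phi> f k +
  fixes \<tau> :: "real \<times> (real^'n) \<times> real \<Rightarrow> real"
  assumes time_derivative: "fst (frechet_derivative \<phi> (at p) X) = fst X * \<tau> p"
begin

lemma metric_fibre:
  "fst X = 0 \<Longrightarrow> fst Y = 0 \<Longrightarrow> xc (d p X) \<bullet> xc (d p Y) = exp (2 * f p) * (xc X \<bullet> xc Y)"
  using pullback[of p X Y] by (simp add: cw_metric_eq time_derivative)

text \<open>The image of this null vector is null and tangent to a slice, where the metric only
  measures the x part.\<close>

lemma d_v_x: "xc (d p (0,0,b)) = 0"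
  using metric_fibre[of "(0,0,b)" "(0,0,b)"] by simp

lemma d_v_v: "\<tau> p * vc (d p (0,0,1)) = exp (2 * f p)"
  using pullback[of p "(1,0,0)" "(0,0,1)"] d_v_x[of p 1] by (simp add: cw_metric_eq time_derivative)

lemma d_x: "xc (d p X) = fst X *\<^sub>R xc (d p (1,0,0)) + xc (d p (0, xc X, 0))"
  using arg_cong[OF d_decompose[of p X], of xc] d_v_x[of p 1] by simp

lemma d_fibre: "xc (d p (0, x, v)) = xc (d p (0, x, 0))"
  using d_x[of p "(0,x,v)"] by simp

text \<open>The x part B of the differential on x directions satisfies dB = k B dt. In the Hessian
  equation the Christoffel vector of (0,\<xi>,0) and Y has t part 0 and x part k \<xi> times
  \<open>fst Y\<close>, and its v part is invisible by \<open>d_v_x\<close>.\<close>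

lemma x_derivative_slice:
  "((\<lambda>q. xc (d q (0,\<xi>,0))) has_derivative (\<lambda>Y. fst Y *\<^sub>R (k p *\<^sub>R xc (d p (0,\<xi>,0))))) (at p)"
proof -
  have "xc (d p (conformal_christoffel S (k p) p (0,\<xi>,0) Y)) = fst Y *\<^sub>R (k p *\<^sub>R xc (d p (0,\<xi>,0)))" for Y
  proof -
    have "conformal_christoffel S (k p) p (0,\<xi>,0) Y = (0, (fst Y * k p) *\<^sub>R \<xi>, vc (conformal_christoffel S (k p) p (0,\<xi>,0) Y))"
      by (simp add: conformal_christoffel_def cw_christoffel_def prod_eq_iff)
    then have "xc (d p (conformal_christoffel S (k p) p (0,\<xi>,0) Y)) = xc (d p (0, (fst Y * k p) *\<^sub>R \<xi>, 0))"
      using d_fibre by metis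
    also have "(0, (fst Y * k p) *\<^sub>R \<xi>, 0) = (fst Y * k p) *\<^sub>R (0::real, \<xi>, 0::real)" by simp
    finally show ?thesis by (simp only: linear_cmul[OF linear_d]) simp
  qed
  then show ?thesis
    using has_derivative_fst[OF has_derivative_snd[OF has_dd[of "(0,\<xi>,0)" p]]]
    unfolding hessian_x by (simp add: time_derivative)
qed

lemma d_x_slice: "xc (d p (0,\<xi>,0)) = xc (d (fst p, 0) (0,\<xi>,0))"
  using slice_derivative(1)[OF x_derivative_slice] .

lemma factor_slice: "f p = f (fst p, 0)" "k p = k (fst p, 0)"
  using slice_derivative(1,2)[OF factor_derivative] .

lemma time_slice: "fst (\<phi> p) = fst (\<phi> (fst p, 0))" "\<tau> p = \<tau> (fst p, 0)"
proof -
  have "((\<lambda>q. fst (\<phi> q)) has_derivative (\<lambda>X. fst X *\<^sub>R \<tau> p)) (at p)" for p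
    using has_derivative_fst[OF has_d[of p]] by (simp add: time_derivative)
  from slice_derivative(1,2)[OF this]
  show "fst (\<phi> p) = fst (\<phi> (fst p, 0))" "\<tau> p = \<tau> (fst p, 0)" by auto
qed

text \<open>Along the ray through (x, v) in the slice, linearity of the differential makes the
  derivative of g the constant c.\<close>

lemma affine_on_slice:
  fixes g :: "real \<times> (real^'n) \<times> real \<Rightarrow> 'b::real_normed_vector"
  assumes "\<And>p. (g has_derivative g' p) (at p)"
    and "\<And>y. g' (t, y) (0, x, v) = c"
  shows "g (t, x, v) = g (t, 0) + c"
proof -
  have "((\<lambda>r. g (t, r *\<^sub>R (x, v)) - r *\<^sub>R c) has_derivative (\<lambda>h. g' (t, r *\<^sub>R (x, v)) (0, h *\<^sub>R (x, v)) - h *\<^sub>R c)) (at r)" for r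
    by (intro has_derivative_diff has_derivative_compose[OF _ assms(1)]) (auto intro!: derivative_eq_intros)
  moreover have "g' (t, r *\<^sub>R (x, v)) (0, h *\<^sub>R (x, v)) = h *\<^sub>R c" for r h
    using linear_cmul[OF has_derivative_linear[OF assms(1)], of "(t, r *\<^sub>R (x, v))" h "(0, x, v)"] assms(2) by simp
  ultimately have "((\<lambda>r. g (t, r *\<^sub>R (x, v)) - r *\<^sub>R c) has_derivative (\<lambda>h. 0)) (at r)" for r
    by simp
  then obtain e where e: "\<And>r. g (t, r *\<^sub>R (x, v)) - r *\<^sub>R c = e"
    using has_derivative_zero_constant[of UNIV "\<lambda>r. g (t, r *\<^sub>R (x, v)) - r *\<^sub>R c"] by auto
  from e[of 0] e[of 1] show ?thesis by (simp add: zero_prod_def algebra_simps)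
qed

lemma x_affine: "xc (\<phi> (t, x, v)) = xc (\<phi> (t, 0)) + xc (d (t, 0) (0, x, 0))"
proof (rule affine_on_slice)
  show "((\<lambda>q. xc (\<phi> q)) has_derivative (\<lambda>X. xc (d p X))) (at p)" for p
    by (intro has_derivative_fst has_derivative_snd has_d)
  show "xc (d (t, y) (0, x, v)) = xc (d (t, 0) (0, x, 0))" for y
    using d_fibre[of "(t, y)" x v] d_x_slice[of "(t, y)" x] by simp
qed

lemma v_affine: "vc (\<phi> (t, x, v)) = vc (\<phi> (t, x, 0)) + v * (exp (2 * f (t, 0)) / \<tau> (t, 0))"
proof -
  define c where "c = exp (2 * f (t, 0)) / \<tau> (t, 0)"
  have v1: "vc (d (t, y) (0, 0, 1)) = c" for y
    using d_v_v[of "(t, y)"] factor_slice(1)[of "(t, y)"] time_slice(2)[of "(t, y)"]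
    \<comment> \<open>The case \<tau> = 0 contradicts \<open>d_v_v\<close>, whose right-hand side is
      positive.\<close>
    by (cases "\<tau> (t, 0) = 0") (auto simp: c_def field_simps)
  have "((\<lambda>r. vc (\<phi> (t, x, r))) has_derivative (\<lambda>h. vc (d (t, x, r) (0, 0, h)))) (at r)" for r
    by (intro has_derivative_snd has_derivative_compose[OF _ has_d]) (auto intro!: derivative_eq_intros)
  moreover have "vc (d (t, x, r) (0, 0, h)) = h * c" for r h
    using linear_cmul[OF linear_d, of "(t, x, r)" h "(0,0,1)"] v1[of "(x, r)"] by simp
  ultimately have 1: "((\<lambda>r. vc (\<phi> (t, x, r))) has_derivative (\<lambda>h. h * c)) (at r)" for r
    by simp
  have "((\<lambda>r. vc (\<phi> (t, x, r)) - r * c) has_derivative (\<lambda>h. h * c - h * c)) (at r)" for r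
    by (intro has_derivative_diff 1) (auto intro!: derivative_eq_intros)
  then obtain e where e: "\<And>r. vc (\<phi> (t, x, r)) - r * c = e"
    using has_derivative_zero_constant[of UNIV "\<lambda>r. vc (\<phi> (t, x, r)) - r * c"] by auto
  from e[of 0] e[of v] show ?thesis by (simp add: c_def)
qed

lemma x_similarity: "norm (xc (d p (0, x, 0))) = exp (f p) * norm x"
proof -
  have "norm (xc (d p (0, x, 0))) ^ 2 = (exp (f p) * norm x) ^ 2"
    using metric_fibre[of "(0,x,0)" "(0,x,0)" p]
    by (simp add: power2_norm_eq_inner power_mult_distrib flip: exp_double)
  then show ?thesis by simp
qed

text \<open>The Hessian in the directions (1,0,0) and (0,x,v) has x part k B x, where B is the x
  part of the differential on x directions; it is constant on the slice.\<close>

lemma d_t_x: "xc (d (t, x, v) (1,0,0)) = xc (d (t, 0) (1,0,0)) + k (t, 0) *\<^sub>R xc (d (t, 0) (0, x, 0))"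
proof (rule affine_on_slice)
  show "((\<lambda>q. xc (d q (1,0,0))) has_derivative (\<lambda>Y. xc (dd p (1,0,0) Y))) (at p)" for p
    by (intro has_derivative_fst has_derivative_snd has_dd)
  fix y :: "(real^'n) \<times> real"
  let ?p = "(t, y)"
  have "xc (dd ?p (1,0,0) (0, x, v)) = xc (d ?p (conformal_christoffel S (k ?p) ?p (1,0,0) (0,x,v)))"
    by (simp add: hessian_x time_derivative)
  also have "conformal_christoffel S (k ?p) ?p (1,0,0) (0,x,v)
      = (0, k ?p *\<^sub>R x, vc (conformal_christoffel S (k ?p) ?p (1,0,0) (0,x,v)))"
    by (simp add: conformal_christoffel_def cw_christoffel_def prod_eq_iff)
  also have "xc (d ?p \<dots>) = xc (d ?p (0, k ?p *\<^sub>R x, 0))"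
    by (rule d_fibre)
  also have "\<dots> = k (t, 0) *\<^sub>R xc (d (t, 0) (0, x, 0))"
    using linear_cmul[OF linear_d, of ?p "k ?p" "(0,x,0)"] d_x_slice[of ?p x] factor_slice(2)[of ?p] by simp
  finally show "xc (dd ?p (1,0,0) (0, x, v)) = k (t, 0) *\<^sub>R xc (d (t, 0) (0, x, 0))" .
qed

lemma second_t_x:
  "xc (dd p (1,0,0) (1,0,0)) = (\<tau> p * \<tau> p) *\<^sub>R (S *v xc (\<phi> p)) - xc (d p (0, S *v xc p, 0))
     + (2 * k p) *\<^sub>R xc (d p (1,0,0))"
proof -
  let ?V = "conformal_christoffel S (k p) p (1,0,0) (1,0,0)"
  have "xc (d p ?V) = fst ?V *\<^sub>R xc (d p (1,0,0)) + xc (d p (0, xc ?V, 0))"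
    by (rule d_x)
  moreover have "fst ?V = 2 * k p" "xc ?V = - (S *v xc p)"
    by (simp_all add: conformal_christoffel_def cw_christoffel_def)
  moreover have "d p (0, - (S *v xc p), 0) = - d p (0, S *v xc p, 0)"
    using linear_neg[OF linear_d, of p "(0, S *v xc p, 0)"] by simp
  ultimately show ?thesis
    by (simp add: hessian_x time_derivative)
qed

text \<open>
  The difference of the equations \<open>second_t_x\<close> at the points \<open>(t, x, 0)\<close> and \<open>(t, 0, 0)\<close>.
\<close>

lemma transverse_equation:
  assumes "((\<lambda>t. k (t, 0)) has_real_derivative k') (at t)"
  shows "(\<tau> (t, 0) * \<tau> (t, 0)) *\<^sub>R (S *v xc (d (t, 0) (0, x, 0)))
    = xc (d (t, 0) (0, S *v x, 0)) + (k' - k (t, 0) * k (t, 0)) *\<^sub>R xc (d (t, 0) (0, x, 0))"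
proof -
  let ?B = "\<lambda>t x. xc (d (t, 0) (0, x, 0))"
  let ?k = "k (t, 0)" and ?\<tau> = "\<tau> (t, 0)"
  have B: "((\<lambda>t. ?B t x) has_vector_derivative ?k *\<^sub>R ?B t x) (at t)"
    using slice_derivative(3)[OF x_derivative_slice] .
  have E: "((\<lambda>t. xc (d (t, y) (1,0,0))) has_vector_derivative xc (dd (t, y) (1,0,0) (1,0,0))) (at t)" for y
  proof -
    have "((\<lambda>t. xc (d (t, y) (1,0,0))) has_derivative (\<lambda>h. xc (dd (t, y) (1,0,0) (h, 0)))) (at t)"
      by (intro has_derivative_fst has_derivative_snd has_derivative_compose[OF _ has_dd])
        (auto intro!: derivative_eq_intros)
    moreover have "dd (t, y) (1,0,0) (h, 0) = h *\<^sub>R dd (t, y) (1,0,0) (1,0,0)" for h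
      using linear_cmul[OF linear_second_derivative[OF smooth], of "(t, y)" "(1,0,0)" h "(1,0,0)"]
      by (simp add: zero_prod_def)
    ultimately show ?thesis
      by (simp add: has_vector_derivative_def)
  qed
  \<comment> \<open>Differentiating \<open>d_t_x\<close> in t, with B' = k B, gives a second
    expression for the second t-derivative at (t, x, 0); comparison with \<open>second_t_x\<close>
    eliminates the terms at (t, 0, 0).\<close>
  have "((\<lambda>t. xc (d (t, 0) (1,0,0)) + k (t, 0) *\<^sub>R ?B t x) has_vector_derivative
      xc (dd (t, 0) (1,0,0) (1,0,0)) + (?k *\<^sub>R (?k *\<^sub>R ?B t x) + k' *\<^sub>R ?B t x)) (at t)"
    by (intro has_vector_derivative_add has_vector_derivative_scaleR B E assms)
  from vector_derivative_unique_at[OF E[of "(x, 0)", unfolded d_t_x] this]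
  have "xc (dd (t, x, 0) (1,0,0) (1,0,0)) = xc (dd (t, 0) (1,0,0) (1,0,0)) + (?k *\<^sub>R (?k *\<^sub>R ?B t x) + k' *\<^sub>R ?B t x)" .
  moreover have "xc (dd (t, x, 0) (1,0,0) (1,0,0)) = (?\<tau> * ?\<tau>) *\<^sub>R (S *v xc (\<phi> (t, 0))) + (?\<tau> * ?\<tau>) *\<^sub>R (S *v ?B t x)
      - ?B t (S *v x) + (2 * ?k) *\<^sub>R xc (d (t, 0) (1,0,0)) + (2 * ?k * ?k) *\<^sub>R ?B t x"
    unfolding second_t_x x_affine d_t_x
    using time_slice(2)[of "(t, x, 0)"] factor_slice(2)[of "(t, x, 0)"] d_x_slice[of "(t, x, 0)" "S *v x"]
    by (simp add: matrix_vector_right_distrib algebra_simps)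
  moreover have "xc (dd (t, 0) (1,0,0) (1,0,0)) = (?\<tau> * ?\<tau>) *\<^sub>R (S *v xc (\<phi> (t, 0))) + (2 * ?k) *\<^sub>R xc (d (t, 0) (1,0,0))"
    using second_t_x[of "(t, 0)"] linear_0[OF linear_d] by (simp flip: zero_prod_def)
  ultimately have "(?\<tau> * ?\<tau>) *\<^sub>R (S *v ?B t x) - ?B t (S *v x) + (2 * ?k * ?k) *\<^sub>R ?B t x = ?k *\<^sub>R (?k *\<^sub>R ?B t x) + k' *\<^sub>R ?B t x"
    by (simp add: algebra_simps)
  then show ?thesis
    by (simp add: vec_eq_iff algebra_simps)
qed

text \<open>\<open>transverse_equation\<close> is the hypothesis of
  \<open>similar_to_affine_multiple\<close> with r = \<tau>^2, q = k' - k^2 and M the x part of the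
  differential, which is injective as a similarity.\<close>

lemma time_square:
  assumes nonscalar: "\<nexists>c. S = mat c"
  shows "\<tau> p * \<tau> p = 1"
proof -
  let ?t = "fst p"
  \<comment> \<open>k is the t-derivative of the smooth function f and is therefore
    differentiable.\<close>
  have k: "k q = frechet_derivative f (at q) (1,0,0)" for q
    using fun_cong[OF frechet_derivative_at[OF factor_derivative[of q]], of "(1,0,0)"] by simp
  have "((\<lambda>t. k (t, 0)) has_derivative (\<lambda>h. second_derivative f (?t, 0) (1,0,0) (h, 0))) (at ?t)"
    unfolding k
    by (intro has_derivative_compose[OF _ smooth_on_has_second_derivative[OF smooth_factor UNIV_I]])
      (auto intro!: derivative_eq_intros)
  then obtain k' where k': "((\<lambda>t. k (t, 0)) has_real_derivative k') (at ?t)"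
    by (rule has_real_derivative)
  let ?B = "\<lambda>x. xc (d (?t, 0) (0, x, 0))"
  have "linear ?B"
    using linear_add[OF linear_d, of "(?t, 0)" "(0,_,0)" "(0,_,0)"] linear_cmul[OF linear_d, of "(?t, 0)" _ "(0,_,0)"]
    by (intro linearI) simp_all
  then have M: "matrix ?B *v x = ?B x" for x
    by (simp add: matrix_works linear_matrix_vector_mul_eq)
  have "inj ?B"
  proof (rule linear_injective_0[OF \<open>linear ?B\<close>, THEN iffD2], intro allI impI)
    fix x assume "?B x = 0"
    with x_similarity[of "(?t, 0)" x] show "x = 0" by simp
  qed
  then have "invertible (matrix ?B)"
    by (metis (no_types, lifting) M ext invertible_left_inverse matrix_left_invertible_injective)
  then have "\<tau> (?t, 0) * \<tau> (?t, 0) = 1"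
    by (rule similar_to_affine_multiple[OF S_sym nonscalar _ _ ]) (use transverse_equation[OF k'] in \<open>auto simp: M\<close>)
  then show ?thesis using time_slice(2)[of p] by simp
qed

text \<open>Differentiating \<tau>^2 = 1 gives 2 \<tau> d\<tau> = 0, so \<tau> is a constant sign
  and the time component is affine.\<close>

lemma time_affine:
  assumes nonscalar: "\<nexists>c. S = mat c"
  obtains \<epsilon> \<beta> where "\<epsilon> = 1 \<or> \<epsilon> = -1" "\<And>p. \<tau> p = \<epsilon>" "\<And>p. fst (\<phi> p) = \<epsilon> * fst p + \<beta>"
proof -
  have has: "(\<tau> has_derivative (\<lambda>Y. fst (dd p (1,0,0) Y))) (at p)" for p
    using has_derivative_fst[OF has_dd[of "(1,0,0)" p]] by (simp add: time_derivative)
  have "((\<lambda>q. \<tau> q * \<tau> q) has_derivative (\<lambda>Y. \<tau> p * fst (dd p (1,0,0) Y) + fst (dd p (1,0,0) Y) * \<tau> p)) (at p)" for p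
    by (rule has_derivative_mult[OF has has])
  then have "((\<lambda>q. 1) has_derivative (\<lambda>Y. 2 * \<tau> p * fst (dd p (1,0,0) Y))) (at p)" for p
    by (simp add: time_square[OF nonscalar] algebra_simps)
  then have "2 * \<tau> p * fst (dd p (1,0,0) Y) = 0" for p Y
    using has_derivative_unique[OF _ has_derivative_const] by metis
  moreover have "\<tau> p \<noteq> 0" for p
    using time_square[OF nonscalar, of p] by auto
  ultimately have "(\<tau> has_derivative (\<lambda>Y. 0)) (at p)" for p
    using has[of p] by simp
  then obtain \<epsilon> where \<epsilon>: "\<And>p. \<tau> p = \<epsilon>"
    using has_derivative_zero_constant[of UNIV \<tau>] by auto
  have "((\<lambda>q. fst (\<phi> q) - \<epsilon> * fst q) has_derivative (\<lambda>X. 0)) (at p)" for p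
    by (rule derivative_eq_intros has_d refl)+ (simp add: time_derivative \<epsilon>)
  then obtain \<beta> where "\<forall>p. fst (\<phi> p) - \<epsilon> * fst p = \<beta>"
    using has_derivative_zero_constant[of UNIV "\<lambda>q. fst (\<phi> q) - \<epsilon> * fst q"] by auto
  moreover have "\<epsilon> = 1 \<or> \<epsilon> = -1"
    using time_square[OF nonscalar] \<epsilon> by (simp add: square_eq_1_iff)
  ultimately show ?thesis
    using \<epsilon> by (intro that[of \<epsilon> \<beta>]) (auto simp: algebra_simps)
qed

end

section \<open>Cahen-Wallach spaces with scalar matrix are conformally flat\<close>

lemma mat_vector_mult: "mat c *v x = c *\<^sub>R x" for x :: "real^'n"
  by (simp add: matrix_vector_mult_def mat_def vec_eq_iff if_distribR if_distrib sum.delta cong: if_cong)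

text \<open>
  The Riccati equation \<open>T' = T\<^sup>2 - l\<close> for \<open>T = F'\<close> makes \<open>e\<^bsup>2F(t)\<^esup> g\<close> flat when \<open>S = l I\<close>.
\<close>

locale conformal_potential =
  fixes J :: "real set" and F T :: "real \<Rightarrow> real" and l :: real
  assumes open_J: "open J"
    and F_derivative: "t \<in> J \<Longrightarrow> (F has_real_derivative T t) (at t)"
    and T_derivative: "t \<in> J \<Longrightarrow> (T has_real_derivative T t * T t - l) (at t)"
begin

section \<open>The strip over J and the flat rescaled metric on it\<close>

definition strip :: "(real \<times> (real^'n) \<times> real) set" where
  "strip = J \<times> UNIV"

lemma open_strip: "open strip"
  by (simp add: strip_def open_Times open_J)

lemma F_has_derivative:
  "p \<in> strip \<Longrightarrow> ((\<lambda>q. F (fst q)) has_derivative (\<lambda>X. fst X * T (fst p))) (at p)"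
  by (rule has_derivative_eq_rhs[OF DERIV_compose_FDERIV[OF F_derivative has_derivative_fst[OF has_derivative_ident]]])
    (auto simp: strip_def)

lemma T_has_derivative:
  "p \<in> strip \<Longrightarrow> ((\<lambda>q. T (fst q)) has_derivative (\<lambda>X. fst X * (T (fst p) * T (fst p) - l))) (at p)"
  by (rule has_derivative_eq_rhs[OF DERIV_compose_FDERIV[OF T_derivative has_derivative_fst[OF has_derivative_ident]]])
    (auto simp: strip_def)

lemma exp_F_has_derivative:
  "p \<in> strip \<Longrightarrow> ((\<lambda>q. exp (2 * F (fst q))) has_derivative (\<lambda>X. (2 * fst X) * (T (fst p) * exp (2 * F (fst p))))) (at p)"
  by (rule derivative_eq_intros F_has_derivative refl | assumption)+ (simp add: fun_eq_iff)

text \<open>Bootstrapping: the Riccati equation makes T' a polynomial in T, so each degree of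
  differentiability yields the next.\<close>

lemma smooth_T: "smooth_on (strip :: (real \<times> (real^'n) \<times> real) set) (\<lambda>p. T (fst p))"
  unfolding smooth_on_def
proof
  fix k
  show "Ck_on k (strip :: (real \<times> (real^'n) \<times> real) set) (\<lambda>p. T (fst p))"
  proof (induction k)
    case 0
    show ?case
      unfolding Ck_on.simps
      by (intro continuous_at_imp_continuous_on ballI) (rule has_derivative_continuous[OF T_has_derivative])
  next
    case (Suc k)
    have "Ck_on k (strip :: (real \<times> (real^'n) \<times> real) set) (\<lambda>p. fst v * (T (fst p) * T (fst p) + - l))" for v :: "real \<times> (real^'n) \<times> real"
      by (intro Ck_on_mult Ck_on_add Suc Ck_on_const open_strip)
    then show ?case
      by (intro Ck_on_SucI[OF open_strip T_has_derivative]) simp_all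
  qed
qed

lemma smooth_F: "smooth_on (strip :: (real \<times> (real^'n) \<times> real) set) (\<lambda>p. F (fst p))"
  unfolding smooth_on_def
proof
  fix k
  show "Ck_on k (strip :: (real \<times> (real^'n) \<times> real) set) (\<lambda>p. F (fst p))"
  proof (rule Ck_on_Suc_imp, rule Ck_on_SucI[OF open_strip F_has_derivative])
    fix v :: "real \<times> (real^'n) \<times> real"
    show "Ck_on k strip (\<lambda>p :: real \<times> (real^'n) \<times> real. fst v * T (fst p))"
      using smooth_T unfolding smooth_on_def by (intro Ck_on_mult Ck_on_const open_strip) blast
  qed
qed

lemma smooth_exp_F: "smooth_on (strip :: (real \<times> (real^'n) \<times> real) set) (\<lambda>p. exp (2 * F (fst p)))"
  unfolding smooth_on_def
proof
  fix k
  show "Ck_on k (strip :: (real \<times> (real^'n) \<times> real) set) (\<lambda>p. exp (2 * F (fst p)))"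
  proof (induction k)
    case 0
    show ?case
      unfolding Ck_on.simps
      by (intro continuous_at_imp_continuous_on ballI) (rule has_derivative_continuous[OF exp_F_has_derivative])
  next
    case (Suc k)
    have "Ck_on k strip (\<lambda>p :: real \<times> (real^'n) \<times> real. (2 * fst v) * (T (fst p) * exp (2 * F (fst p))))" for v :: "real \<times> (real^'n) \<times> real"
      using smooth_T Suc unfolding smooth_on_def by (intro Ck_on_mult Ck_on_const open_strip) blast+
    then show ?case
      by (intro Ck_on_SucI[OF open_strip exp_F_has_derivative])
  qed
qed

abbreviation S0 :: "real^'n^'n" where "S0 \<equiv> mat l"

definition flat_metric :: "(real \<times> (real^'n) \<times> real) metric_field" where
  "flat_metric = (\<lambda>p X Y. exp (2 * F (fst p)) * cw_metric S0 p X Y)"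

lemma smooth_inner_square: "smooth_on (strip :: (real \<times> (real^'n) \<times> real) set) (\<lambda>p. xc p \<bullet> xc p)"
  unfolding smooth_on_def
proof
  fix k
  have "((\<lambda>q. xc q \<bullet> xc q) has_derivative (\<lambda>X. 2 * (xc X \<bullet> xc p))) (at p)" for p :: "real \<times> (real^'n) \<times> real"
    by (rule derivative_eq_intros refl | simp add: inner_commute)+
  moreover have "bounded_linear (\<lambda>p :: real \<times> (real^'n) \<times> real. 2 * (xc v \<bullet> xc p))" for v :: "real \<times> (real^'n) \<times> real"
    by (intro bounded_linear_intros)
  ultimately show "Ck_on k (strip :: (real \<times> (real^'n) \<times> real) set) (\<lambda>p. xc p \<bullet> xc p)"
    by (rule Ck_on_Suc_imp[OF Ck_on_SucI[OF open_strip _ Ck_on_bounded_linear[OF open_strip]]])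
qed

lemma semi_riemannian_flat_metric: "semi_riemannian_on strip flat_metric"
  unfolding semi_riemannian_on_def
proof (intro conjI ballI allI impI)
  fix p X Y :: "real \<times> (real^'n) \<times> real"
  show "bilinear (flat_metric p)"
    using bilinear_cw_metric[of S0 p]
    by (auto simp: flat_metric_def bilinear_def linear_iff algebra_simps)
  show "flat_metric p X Y = flat_metric p Y X"
    by (simp add: flat_metric_def cw_metric_commute)
  show "X = 0" if "\<forall>Y. flat_metric p X Y = 0"
  proof (rule cw_metric_nondegenerate)
    show "cw_metric S0 p X Y = 0" for Y
      using that[rule_format, of Y] by (simp add: flat_metric_def)
  qed
  show "smooth_on strip (\<lambda>p. flat_metric p X Y)"
    unfolding smooth_on_def
  proof
    fix k
    have "Ck_on k strip (\<lambda>p :: real \<times> (real^'n) \<times> real. exp (2 * F (fst p)) * ((vc X * fst Y + fst X * vc Y + xc X \<bullet> xc Y) + (l * (fst X * fst Y)) * (xc p \<bullet> xc p)))"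
      using smooth_exp_F smooth_inner_square unfolding smooth_on_def
      by (intro Ck_on_mult Ck_on_add Ck_on_const open_strip) blast+
    then show "Ck_on k strip (\<lambda>p. flat_metric p X Y)"
      by (rule Ck_on_cong[OF open_strip, rotated]) (simp add: flat_metric_def cw_metric_eq mat_vector_mult algebra_simps)
  qed
qed

lemma flat_metric_derivative:
  assumes "p \<in> strip"
  shows "frechet_derivative (\<lambda>q. flat_metric q X Y) (at p) Z = exp (2 * F (fst p)) *
    (2 * (xc p \<bullet> (S0 *v xc Z)) * (fst X * fst Y) + 2 * T (fst p) * fst Z * cw_metric S0 p X Y)"
proof -
  have "((\<lambda>q. cw_metric S0 q X Y) has_derivative (\<lambda>Z. 2 * (xc p \<bullet> (S0 *v xc Z)) * (fst X * fst Y))) (at p)"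
    using cw_metric_has_derivative[OF _ has_derivative_ident has_derivative_const has_derivative_const, of S0 X Y p]
    by (simp add: cw_metric_eq)
  from has_derivative_mult[OF exp_F_has_derivative[OF assms] this]
  show ?thesis
    unfolding flat_metric_def
    by (subst frechet_derivative_at[symmetric], assumption) (simp add: algebra_simps)
qed

text \<open>The closed form satisfies the Koszul formula, and nondegeneracy makes the solution
  unique.\<close>

lemma christoffel_flat_metric:
  assumes "p \<in> strip"
  shows "christoffel flat_metric p X Y = conformal_christoffel S0 (T (fst p)) p X Y"
  unfolding christoffel_def
proof (rule the_equality)
  let ?V = "conformal_christoffel S0 (T (fst p)) p X Y"
  let ?E = "\<lambda>Z. frechet_derivative (\<lambda>q. flat_metric q Y Z) (at p) X
     + frechet_derivative (\<lambda>q. flat_metric q X Z) (at p) Y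
     - frechet_derivative (\<lambda>q. flat_metric q X Y) (at p) Z"
  have sym: "transpose S0 = S0" by simp
  have *: "2 * flat_metric p ?V Z = ?E Z" for Z
    unfolding flat_metric_derivative[OF assms]
    unfolding flat_metric_def conformal_christoffel_koszul[OF sym]
    by (simp add: algebra_simps)
  then show "\<forall>Z. 2 * flat_metric p ?V Z = ?E Z" by blast
  fix V assume V: "\<forall>Z. 2 * flat_metric p V Z = ?E Z"
  have "2 * flat_metric p V Z = 2 * flat_metric p ?V Z" for Z
    unfolding * by (rule V[rule_format])
  then have "cw_metric S0 p (V - ?V) Z = 0" for Z
    by (simp add: flat_metric_def cw_metric_diff_left)
  from cw_metric_nondegenerate[OF this] show "V = ?V" by simp
qed

lemma conformal_christoffel_scalar:
  "conformal_christoffel S0 k p Y Z =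
    (2 * k * fst Y * fst Z,
     k *\<^sub>R (fst Y *\<^sub>R xc Z + fst Z *\<^sub>R xc Y) - (l * fst Y * fst Z) *\<^sub>R xc p,
     l * (fst Z * (xc p \<bullet> xc Y) + fst Y * (xc p \<bullet> xc Z)) - k * (l * (fst Y * fst Z) * (xc p \<bullet> xc p) + xc Y \<bullet> xc Z))"
  by (simp add: conformal_christoffel_def cw_christoffel_def cw_metric_eq mat_vector_mult algebra_simps prod_eq_iff)

lemma christoffel_flat_metric_derivative:
  assumes "p \<in> strip"
  defines "D \<equiv> T (fst p) * T (fst p) - l"
  shows "frechet_derivative (\<lambda>q. christoffel flat_metric q Y Z) (at p) X =
    (2 * (fst X * D) * fst Y * fst Z,
     (fst X * D) *\<^sub>R (fst Y *\<^sub>R xc Z + fst Z *\<^sub>R xc Y) - (l * fst Y * fst Z) *\<^sub>R xc X,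
     l * (fst Z * (xc X \<bullet> xc Y) + fst Y * (xc X \<bullet> xc Z))
      - (fst X * D) * (l * (fst Y * fst Z) * (xc p \<bullet> xc p) + xc Y \<bullet> xc Z)
      - T (fst p) * (l * (fst Y * fst Z) * (2 * (xc p \<bullet> xc X))))" (is "_ = ?D' X")
proof -
  have "((\<lambda>q. conformal_christoffel S0 (T (fst q)) q Y Z) has_derivative ?D') (at p)"
    unfolding conformal_christoffel_scalar
    by (rule derivative_eq_intros T_has_derivative[OF assms(1)] refl)+
      (simp add: fun_eq_iff D_def algebra_simps inner_commute)
  then have "((\<lambda>q. christoffel flat_metric q Y Z) has_derivative ?D') (at p)"
    by (rule has_derivative_transform_within_open[OF _ open_strip assms(1)]) (simp add: christoffel_flat_metric)
  from fun_cong[OF frechet_derivative_at[OF this], of X] show ?thesis by (rule sym)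
qed

text \<open>Direct computation from the closed forms; the derivative T' enters as T^2 - l, and then
  all terms cancel.\<close>

lemma flat_flat_metric: "flat_on strip flat_metric"
  unfolding flat_on_def
proof (intro ballI allI)
  fix p X Y Z :: "real \<times> (real^'n) \<times> real"
  assume p: "p \<in> strip"
  show "riemann_curvature flat_metric p X Y Z = 0"
    unfolding riemann_curvature_def christoffel_flat_metric_derivative[OF p] christoffel_flat_metric[OF p]
      conformal_christoffel_scalar
    by (simp add: zero_prod_def algebra_simps inner_commute vec_eq_iff)
qed

lemma diffeo_id: "open U \<Longrightarrow> diffeo_on U U id"
  unfolding diffeo_on_def smooth_on_def
proof (intro conjI allI)
  assume U: "open U"
  show "bij_betw id U U" by simp
  show 1: "Ck_on k U id" for k
    by (rule Ck_on_bounded_linear[OF U]) (simp add: id_def)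
  show "Ck_on k U (inv_into U id)" for k
    by (rule Ck_on_cong[OF U _ 1]) (metis bij_betw_id bij_betw_inv_into_left id_apply)
qed

lemma conformally_flat_at:
  fixes p :: "real \<times> (real^'n) \<times> real"
  assumes "fst p \<in> J"
  shows "\<exists>U (W :: (real \<times> (real^'n) \<times> real) set) h \<phi> f. open U \<and> p \<in> U \<and> U \<subseteq> UNIV \<and> open W \<and>
        semi_riemannian_on W h \<and> flat_on W h \<and> conformal_diffeo U (cw_metric S0) W h \<phi> f"
proof (intro exI conjI)
  show "open strip" "open strip" by (rule open_strip)+
  show "p \<in> strip" using assms by (cases p) (simp add: strip_def)
  show "semi_riemannian_on strip flat_metric" "flat_on strip flat_metric"
    by (rule semi_riemannian_flat_metric flat_flat_metric)+
  show "conformal_diffeo strip (cw_metric S0) strip flat_metric id (\<lambda>p. F (fst p))"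
    by (simp add: conformal_diffeo_def diffeo_id open_strip smooth_F pullback_metric_def flat_metric_def)
qed simp

end

text \<open>Explicit Riccati solutions: the constant \<open>sqrt l\<close> if l \<ge> 0, and
  otherwise w tan(w (t - t0)) with w^2 = - l and t0 the time of p. The latter lives on a bounded
  interval around t0, which suffices for flatness near p.\<close>

lemma scalar_conformally_flat: "conformally_flat_on UNIV (cw_metric (mat l :: real^'n^'n))"
  unfolding conformally_flat_on_def
proof
  fix p :: "real \<times> (real^'n) \<times> real"
  show "\<exists>U (W :: (real \<times> (real^'n) \<times> real) set) h \<phi> f. open U \<and> p \<in> U \<and> U \<subseteq> UNIV \<and> open W \<and>
        semi_riemannian_on W h \<and> flat_on W h \<and> conformal_diffeo U (cw_metric (mat l)) W h \<phi> f"
  proof (cases "l \<ge> 0")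
    case True
    interpret conformal_potential UNIV "\<lambda>t. sqrt l * t" "\<lambda>t. sqrt l" l
      using True by unfold_locales (auto intro!: derivative_eq_intros)
    show ?thesis by (rule conformally_flat_at) simp
  next
    case False
    define w where "w = sqrt (- l)"
    have w: "w > 0" "w * w = - l" using False by (simp_all add: w_def)
    define J where "J = {t. w * (t - fst p) \<in> {-(pi/2)<..<pi/2}}"
    have cos: "cos (w * (t - fst p)) > 0" if "t \<in> J" for t
      using that by (auto simp: J_def intro: cos_gt_zero_pi)
    interpret conformal_potential J "\<lambda>t. - ln (cos (w * (t - fst p)))" "\<lambda>t. w * tan (w * (t - fst p))" l
    proof
      have "J = (\<lambda>t. w * (t - fst p)) -` {-(pi/2)<..<pi/2}" by (auto simp: J_def)
      also have "open \<dots>"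
        by (intro open_vimage open_greaterThanLessThan continuous_intros)
      finally show "open J" .
    next
      fix t assume t: "t \<in> J"
      show "((\<lambda>t. - ln (cos (w * (t - fst p)))) has_real_derivative w * tan (w * (t - fst p))) (at t)"
        using cos[OF t] by (auto intro!: derivative_eq_intros simp: tan_def divide_simps)
    next
      fix t assume t: "t \<in> J"
      let ?u = "w * (t - fst p)"
      have "inverse ((cos ?u)\<^sup>2) = 1 + tan ?u * tan ?u"
        using cos[OF t] sin_cos_squared_add[of ?u] by (simp add: tan_def field_simps power2_eq_square)
      then have "w * (inverse ((cos ?u)\<^sup>2) * w) = w * tan ?u * (w * tan ?u) - l"
        using w by (simp add: algebra_simps)
      moreover have "((\<lambda>t. w * tan (w * (t - fst p))) has_real_derivative w * (inverse ((cos ?u)\<^sup>2) * w)) (at t)"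
        using cos[OF t] by (auto intro!: derivative_eq_intros)
      ultimately show "((\<lambda>t. w * tan (w * (t - fst p))) has_real_derivative w * tan ?u * (w * tan ?u) - l) (at t)"
        by simp
    qed
    show ?thesis by (rule conformally_flat_at) (simp add: J_def)
  qed
qed

section \<open>Essential homotheties\<close>

lemma conformal_diffeoD:
  assumes "conformal_diffeo UNIV g UNIV h \<phi> f"
  shows "bij \<phi>" "smooth_on UNIV \<phi>" "smooth_on UNIV (inv_into UNIV \<phi>)" "smooth_on UNIV f"
    "h (\<phi> p) (frechet_derivative \<phi> (at p) X) (frechet_derivative \<phi> (at p) Y) = exp (2 * f p) * g p X Y"
  using assms by (auto simp: conformal_diffeo_def diffeo_on_def pullback_metric_def)

lemma smooth_has_derivative_comp:
  assumes "smooth_on UNIV \<phi>" "smooth_on UNIV \<psi>"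
  shows "((\<lambda>q. \<phi> (\<psi> q)) has_derivative (\<lambda>X. frechet_derivative \<phi> (at (\<psi> p)) (frechet_derivative \<psi> (at p) X))) (at p)"
  by (rule has_derivative_compose[OF smooth_on_has_derivative[OF assms(2) UNIV_I] smooth_on_has_derivative[OF assms(1) UNIV_I]])

lemma frechet_derivative_inverse:
  assumes "smooth_on UNIV \<phi>" "smooth_on UNIV \<psi>" "\<And>q. \<phi> (\<psi> q) = q"
  shows "frechet_derivative \<phi> (at (\<psi> p)) (frechet_derivative \<psi> (at p) X) = X"
  using has_derivative_unique[OF smooth_has_derivative_comp[OF assms(1,2), of p, unfolded assms(3)] has_derivative_ident]
  by (rule fun_cong)

lemma surj_frechet_derivative:
  assumes "conformal_diffeo UNIV g UNIV h \<phi> f"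
  shows "surj (frechet_derivative \<phi> (at p))"
proof (rule surjI)
  note \<phi> = conformal_diffeoD[OF assms]
  show "frechet_derivative \<phi> (at p) (frechet_derivative (inv_into UNIV \<phi>) (at (\<phi> p)) X) = X" for X
    using frechet_derivative_inverse[OF \<phi>(2,3), of "\<phi> p" X] \<phi>(1)
    by (simp add: bij_is_surj surj_f_inv_f bij_is_inj)
qed

lemma homothety_inverse:
  assumes "conformal_diffeo UNIV g UNIV g \<phi> (\<lambda>p. c)"
  shows "conformal_diffeo UNIV g UNIV g (inv_into UNIV \<phi>) (\<lambda>p. - c)"
proof -
  note \<phi> = conformal_diffeoD[OF assms]
  have inv: "\<phi> (inv_into UNIV \<phi> q) = q" for q
    using \<phi>(1) by (simp add: bij_is_surj surj_f_inv_f)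
  have "g (inv_into UNIV \<phi> p) (frechet_derivative (inv_into UNIV \<phi>) (at p) X) (frechet_derivative (inv_into UNIV \<phi>) (at p) Y) = exp (2 * (- c)) * g p X Y" for p X Y
    using \<phi>(5)[of "inv_into UNIV \<phi> p" "frechet_derivative (inv_into UNIV \<phi>) (at p) X" "frechet_derivative (inv_into UNIV \<phi>) (at p) Y"]
    by (simp add: frechet_derivative_inverse[OF \<phi>(2,3) inv] inv exp_minus field_simps)
  moreover have "smooth_on UNIV (\<lambda>p :: 'a. - c)"
    by (simp add: smooth_on_def Ck_on_const)
  ultimately show ?thesis
    using \<phi> by (simp add: conformal_diffeo_def diffeo_on_def pullback_metric_def bij_imp_bij_inv inv_inv_eq)
qed

lemma cw_conformalI:
  assumes "transpose S = S" "conformal_diffeo UNIV (cw_metric S) UNIV (cw_metric S) \<phi> f"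
    and "\<And>p. (f has_derivative (\<lambda>X. fst X *\<^sub>R k p)) (at p)"
  shows "cw_conformal S \<phi> f k"
  using assms conformal_diffeoD[OF assms(2)] surj_frechet_derivative[OF assms(2)]
  by unfold_locales auto

section \<open>Homotheties, their time maps and essentiality\<close>

locale cw_homothety = cw_conformal_time S \<phi> "\<lambda>p. c" "\<lambda>p. 0" "\<lambda>p. \<alpha>"
  for S :: "real^'n^'n" and \<phi> c \<alpha> +
  fixes \<beta> :: real
  assumes time: "fst (\<phi> p) = \<alpha> * fst p + \<beta>" and sign: "\<alpha> = 1 \<or> \<alpha> = -1"

lemma cw_homothety_exists:
  assumes S: "transpose S = S" "det S \<noteq> 0" "\<nexists>c. S = mat c"
    and \<phi>: "conformal_diffeo UNIV (cw_metric S) UNIV (cw_metric S) \<phi> (\<lambda>p. c)"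
  obtains \<alpha> \<beta> where "cw_homothety S \<phi> c \<alpha> \<beta>"
proof -
  interpret cw_conformal S \<phi> "\<lambda>p. c" "\<lambda>p. 0"
    by (rule cw_conformalI[OF S(1) \<phi>]) simp
  obtain \<alpha> \<beta> where *: "\<And>p. fst (\<phi> p) = \<alpha> * fst p + \<beta>" "\<And>p X. fst (d p X) = \<alpha> * fst X"
    by (rule homothety_time[OF S(2)]) auto
  interpret cw_conformal_time S \<phi> "\<lambda>p. c" "\<lambda>p. 0" "\<lambda>p. \<alpha>"
    by unfold_locales (simp add: *)
  have "cw_homothety S \<phi> c \<alpha> \<beta>"
    using time_square[OF S(3)] by unfold_locales (simp_all add: * square_eq_1_iff)
  then show ?thesis by (rule that)
qed

lemma essential_homothety:
  assumes \<phi>: "conformal_diffeo UNIV (cw_metric S) UNIV (cw_metric S) \<phi> (\<lambda>p. c)"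
    and "essential (cw_metric S) \<phi>" and time: "\<And>p. fst (\<phi> p) = \<alpha> * fst p + \<beta>"
  shows "c \<noteq> 0" "\<alpha> = 1 \<Longrightarrow> \<beta> = 0"
proof -
  note D = conformal_diffeoD[OF \<phi>]
  \<comment> \<open>Such an h would make \<phi> an isometry of e^(2h) g_S; h = 0 and a multiple of t
    are the two functions tried below.\<close>
  have no: "\<not> (\<forall>p. h (\<phi> p) + c = h p)" if "smooth_on UNIV h" for h
  proof
    assume h: "\<forall>p. h (\<phi> p) + c = h p"
    have "exp (2 * h (\<phi> p)) * (exp (2 * c) * x) = exp (2 * h p) * x" for p x
      using h[rule_format, of p, symmetric] by (simp add: exp_add algebra_simps)
    then have "isometry (\<lambda>p X Y. exp (2 * h p) * cw_metric S p X Y) \<phi>"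
      using D by (simp add: isometry_def diffeo_on_def pullback_metric_def fun_eq_iff)
    with that assms(2) show False by (auto simp: essential_def)
  qed
  show "c \<noteq> 0"
    using no[of "\<lambda>p. 0"] by (auto simp: smooth_on_def Ck_on_const)
  show "\<beta> = 0" if "\<alpha> = 1"
  proof (rule ccontr)
    assume "\<beta> \<noteq> 0"
    have "bounded_linear (\<lambda>p :: real \<times> (real^'n) \<times> real. - (c / \<beta>) * fst p)"
      by (intro bounded_linear_intros)
    then have "smooth_on UNIV (\<lambda>p :: real \<times> (real^'n) \<times> real. - (c / \<beta>) * fst p)"
      by (rule smooth_on_bounded_linear[OF open_UNIV])
    from no[OF this] \<open>\<beta> \<noteq> 0\<close> that show False
      by (simp add: time field_simps)
  qed
qed

text \<open>\<zeta> is \<eta> or its inverse, whichever has negative c; a map commuting with \<eta>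
  commutes with both.\<close>

lemma contracting_homothety:
  assumes S: "transpose S = S" "det S \<noteq> 0" "\<nexists>c. S = mat c"
    and \<eta>: "homothety (cw_metric S) \<eta>" "essential (cw_metric S) \<eta>"
  obtains \<zeta> c \<alpha> \<beta> where "cw_homothety S \<zeta> c \<alpha> \<beta>" "c < 0" "\<alpha> = 1 \<longrightarrow> \<beta> = 0"
    "conformal_diffeo UNIV (cw_metric S) UNIV (cw_metric S) \<zeta> (\<lambda>p. c)"
    "\<forall>\<gamma>. \<gamma> \<circ> \<eta> = \<eta> \<circ> \<gamma> \<longrightarrow> \<gamma> \<circ> \<zeta> = \<zeta> \<circ> \<gamma>"
proof -
  from \<eta>(1) obtain c where c: "conformal_diffeo UNIV (cw_metric S) UNIV (cw_metric S) \<eta> (\<lambda>p. c)"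
    by (auto simp: homothety_def)
  obtain \<alpha> \<beta> where h: "cw_homothety S \<eta> c \<alpha> \<beta>"
    by (rule cw_homothety_exists[OF S c])
  note time = cw_homothety.time[OF h]
  note ess = essential_homothety[OF c \<eta>(2) time]
  show ?thesis
  proof (cases "c < 0")
    case True
    with h c ess show ?thesis by (intro that[of \<eta> c \<alpha> \<beta>]) auto
  next
    case False
    have bij: "bij \<eta>" using conformal_diffeoD(1)[OF c] .
    have c': "conformal_diffeo UNIV (cw_metric S) UNIV (cw_metric S) (inv_into UNIV \<eta>) (\<lambda>p. - c)"
      by (rule homothety_inverse[OF c])
    obtain \<alpha>' \<beta>' where h': "cw_homothety S (inv_into UNIV \<eta>) (- c) \<alpha>' \<beta>'"
      by (rule cw_homothety_exists[OF S c'])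
    show ?thesis
    proof (rule that[OF h' _ _ c'])
      show "- c < 0" using False ess(1) by simp
      show "\<alpha>' = 1 \<longrightarrow> \<beta>' = 0"
      proof
        assume that: "\<alpha>' = 1"
        \<comment> \<open>Essentiality is given for \<eta>, so the condition on the inverse is read
          off from the composition of the two time maps.\<close>
        have "t = \<alpha> * (t + \<beta>') + \<beta>" for t
          using time[of "inv_into UNIV \<eta> (t, 0)"] cw_homothety.time[OF h', of "(t, 0)"] that bij
          by (simp add: bij_is_surj surj_f_inv_f)
        from this[of 0] this[of 1] have "\<alpha> = 1" "\<alpha> * \<beta>' + \<beta> = 0" by (simp_all add: algebra_simps)
        with ess(2) show "\<beta>' = 0" by simp
      qed
      show "\<forall>\<gamma>. \<gamma> \<circ> \<eta> = \<eta> \<circ> \<gamma> \<longrightarrow> \<gamma> \<circ> inv_into UNIV \<eta> = inv_into UNIV \<eta> \<circ> \<gamma>"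
      proof (intro allI impI ext)
        fix \<gamma> q assume that: "\<gamma> \<circ> \<eta> = \<eta> \<circ> \<gamma>"
        have "\<eta> (\<gamma> (inv_into UNIV \<eta> q)) = \<gamma> q"
          using fun_cong[OF that, of "inv_into UNIV \<eta> q"] bij by (simp add: bij_is_surj surj_f_inv_f)
        then show "(\<gamma> \<circ> inv_into UNIV \<eta>) q = (inv_into UNIV \<eta> \<circ> \<gamma>) q"
          using bij by (metis bij_inv_eq_iff comp_apply)
      qed
    qed
  qed
qed

text \<open>Used for the distance of iterates to a fixed point: in x with e = 0, and in v with an
  error caused by x.\<close>

lemma perturbed_contraction_tendsto_0:
  fixes a e :: "nat \<Rightarrow> real"
  assumes r: "0 \<le> r" "r < 1" and step: "\<And>k. \<bar>a (Suc k)\<bar> \<le> r * \<bar>a k\<bar> + e k" and e: "e \<longlonglongrightarrow> 0"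
  shows "a \<longlonglongrightarrow> 0"
proof (rule LIMSEQ_I)
  fix \<epsilon> :: real assume "\<epsilon> > 0"
  \<comment> \<open>This tolerance keeps the bound \<epsilon> / 2 stable under one step: r
    \<epsilon> / 2 + \<epsilon> (1 - r) / 2 = \<epsilon> / 2.\<close>
  with r have "\<epsilon> * (1 - r) / 2 > 0" by simp
  from LIMSEQ_D[OF e this] obtain N where N: "\<And>k. k \<ge> N \<Longrightarrow> \<bar>e k\<bar> < \<epsilon> * (1 - r) / 2" by auto
  have bound: "\<bar>a (N + j)\<bar> \<le> r ^ j * \<bar>a N\<bar> + \<epsilon> / 2" for j
  proof (induction j)
    case 0
    show ?case using \<open>\<epsilon> > 0\<close> by simp
  next
    case (Suc j)
    have "\<bar>a (N + Suc j)\<bar> \<le> r * \<bar>a (N + j)\<bar> + e (N + j)"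
      using step[of "N + j"] by simp
    also have "\<dots> \<le> r * (r ^ j * \<bar>a N\<bar> + \<epsilon> / 2) + \<epsilon> * (1 - r) / 2"
      using N[of "N + j"] mult_left_mono[OF Suc r(1)] by (intro add_mono) auto
    also have "\<dots> = r ^ Suc j * \<bar>a N\<bar> + \<epsilon> / 2"
      by (simp add: field_simps)
    finally show ?case .
  qed
  have "(\<lambda>j. r ^ j * \<bar>a N\<bar>) \<longlonglongrightarrow> 0 * \<bar>a N\<bar>"
    by (intro tendsto_intros LIMSEQ_realpow_zero r)
  then have "(\<lambda>j. r ^ j * \<bar>a N\<bar>) \<longlonglongrightarrow> 0" by simp
  from LIMSEQ_D[OF this, of "\<epsilon> / 2"] \<open>\<epsilon> > 0\<close>
  obtain M where M: "\<And>j. j \<ge> M \<Longrightarrow> \<bar>r ^ j * \<bar>a N\<bar>\<bar> < \<epsilon> / 2" by auto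
  show "\<exists>no. \<forall>n\<ge>no. norm (a n - 0) < \<epsilon>"
  proof (intro exI allI impI)
    fix n assume n: "n \<ge> N + M"
    then have "n = N + (n - N)" "n - N \<ge> M" by auto
    with bound[of "n - N"] M[of "n - N"] show "norm (a n - 0) < \<epsilon>"
      by (metis (no_types, opaque_lifting) abs_ge_self add_less_cancel_right diff_zero dual_order.strict_trans2
          field_sum_of_halves le_less_trans real_norm_def)
  qed
qed

section \<open>Action of a homothety on the slices\<close>

context cw_homothety
begin

text \<open>For a homothety k = 0, so the linear part in x is the same on all slices and can be
  taken at the origin.\<close>

lemma x_map: "xc (\<phi> (t, x, v)) = xc (\<phi> (t, 0)) + xc (d 0 (0, x, 0))"
proof -
  have "((\<lambda>q. xc (d q (0, x, 0))) has_derivative (\<lambda>Y. 0)) (at p)" for p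
    using x_derivative_slice[of x p] by simp
  then have "\<exists>b. \<forall>q. xc (d q (0, x, 0)) = b"
    using has_derivative_zero_constant[of UNIV "\<lambda>q. xc (d q (0, x, 0))"] by auto
  then have "xc (d (t, 0) (0, x, 0)) = xc (d 0 (0, x, 0))" by metis
  with x_affine show ?thesis by simp
qed

lemma v_map: "vc (\<phi> (t, x, v)) = vc (\<phi> (t, x, 0)) + v * (exp (2 * c) / \<alpha>)"
  by (rule v_affine)

lemma linear_x: "linear (\<lambda>x. xc (d 0 (0, x, 0)))"
  using linear_add[OF linear_d, of 0 "(0,_,0)" "(0,_,0)"] linear_cmul[OF linear_d, of 0 _ "(0,_,0)"]
  by (intro linearI) simp_all

text \<open>On an invariant slice the fixed point equation is triangular: x is determined by an
  affine map whose linear part is a similarity of ratio e^c \<noteq> 1, and then v by an affine map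
  of slope e^(2c) / \<alpha> \<noteq> 1.\<close>

lemma ex1_fixed_point:
  assumes "c \<noteq> 0" and t: "\<alpha> * t + \<beta> = t"
  shows "\<exists>!y. \<phi> (t, y) = (t, y)"
proof -
  let ?L = "\<lambda>x. x - xc (d 0 (0, x, 0))"
  have lin: "linear ?L"
    by (intro linear_compose_sub linear_ident linear_x)
  have "inj ?L"
  proof (rule linear_injective_0[OF lin, THEN iffD2], intro allI impI)
    fix x assume "?L x = 0"
    with x_similarity[of 0 x] have "norm x = exp c * norm x" by simp
    with \<open>c \<noteq> 0\<close> show "x = 0" by simp
  qed
  then have bij: "bij ?L"
    using linear_inj_imp_surj[OF lin] by (simp add: bij_def)
  have v: "exp (2 * c) / \<alpha> \<noteq> 1"
    using sign \<open>c \<noteq> 0\<close> exp_gt_zero[of "2 * c"] by (auto simp del: exp_gt_zero)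
  have fixed: "\<phi> (t, x, v) = (t, x, v) \<longleftrightarrow> ?L x = xc (\<phi> (t, 0)) \<and> v = vc (\<phi> (t, x, 0)) / (1 - exp (2 * c) / \<alpha>)" for x v
    using time[of "(t, x, v)"] t x_map[of t x v] v_map[of t x v] v
    by (auto simp: prod_eq_iff algebra_simps eq_divide_eq)
  obtain x where x: "?L x = xc (\<phi> (t, 0))"
    using surjD[OF bij_is_surj[OF bij], of "xc (\<phi> (t, 0))"] by auto
  have x_unique: "x' = x" if "?L x' = xc (\<phi> (t, 0))" for x'
    using injD[OF bij_is_inj[OF bij], of x' x] that x by simp
  show ?thesis
  proof (rule ex1I[of _ "(x, vc (\<phi> (t, x, 0)) / (1 - exp (2 * c) / \<alpha>))"])
    show "\<phi> (t, x, vc (\<phi> (t, x, 0)) / (1 - exp (2 * c) / \<alpha>)) = (t, x, vc (\<phi> (t, x, 0)) / (1 - exp (2 * c) / \<alpha>))"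
      unfolding fixed using x by simp
    fix y assume "\<phi> (t, y) = (t, y)"
    then show "y = (x, vc (\<phi> (t, x, 0)) / (1 - exp (2 * c) / \<alpha>))"
      using fixed[of "fst y" "snd y"] x_unique[of "fst y"] by (auto simp: prod_eq_iff)
  qed
qed

end

section \<open>The curve of fixed points and the group action\<close>

locale cw_contraction = cw_homothety S \<phi> c 1 0 for S :: "real^'n^'n" and \<phi> c +
  assumes contracting: "c < 0"
begin

definition fixed_curve :: "real \<Rightarrow> real \<times> (real^'n) \<times> real" where
  "fixed_curve t = (t, THE y. \<phi> (t, y) = (t, y))"

lemma fst_fixed_curve [simp]: "fst (fixed_curve t) = t"
  by (simp add: fixed_curve_def)

lemma fixed_curve_fixed: "\<phi> (fixed_curve t) = fixed_curve t"
  unfolding fixed_curve_def by (rule theI', rule ex1_fixed_point) (use contracting in auto)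

lemma fixed_imp_fixed_curve: "\<phi> p = p \<Longrightarrow> p = fixed_curve (fst p)"
proof -
  assume p: "\<phi> p = p"
  have "\<exists>!y. \<phi> (fst p, y) = (fst p, y)"
    by (rule ex1_fixed_point) (use contracting in auto)
  then have "(THE y. \<phi> (fst p, y) = (fst p, y)) = snd p"
    by (rule the1_equality) (simp add: p)
  then show ?thesis by (simp add: fixed_curve_def)
qed

lemma exp_c: "0 \<le> exp c" "exp c < 1" "exp (2 * c) < 1"
  using contracting by auto

lemma continuous_\<phi>: "continuous_on UNIV \<phi>"
  by (rule smooth_on_continuous[OF smooth])

lemma tendsto_\<phi>: "(f \<longlongrightarrow> a) F \<Longrightarrow> ((\<lambda>x. \<phi> (f x)) \<longlongrightarrow> \<phi> a) F"
  using continuous_on_tendsto_compose[OF continuous_\<phi>] by simp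

lemma xc_fixed_curve: "xc (fixed_curve t) = xc (\<phi> (t, 0)) + xc (d 0 (0, xc (fixed_curve t), 0))"
  using x_map[of t "xc (fixed_curve t)" "vc (fixed_curve t)"] fixed_curve_fixed[of t] by (metis fst_fixed_curve prod.collapse)

lemma vc_fixed_curve: "vc (fixed_curve t) = vc (\<phi> (t, xc (fixed_curve t), 0)) / (1 - exp (2 * c))"
proof -
  have "vc (fixed_curve t) = vc (\<phi> (t, xc (fixed_curve t), 0)) + vc (fixed_curve t) * exp (2 * c)"
    using v_map[of t "xc (fixed_curve t)" "vc (fixed_curve t)"] fixed_curve_fixed[of t] by (metis div_by_1 fst_fixed_curve prod.collapse)
  then show ?thesis using exp_c by (simp add: field_simps)
qed

text \<open>The x error shrinks by e^c at each step. The v error shrinks by e^(2c) up to a term that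
  tends to 0, by continuity of \<phi>, once x converges.\<close>

lemma iterates_tendsto_fixed_curve: "(\<lambda>k. (\<phi> ^^ k) p) \<longlonglongrightarrow> fixed_curve (fst p)"
proof -
  define q where "q k = (\<phi> ^^ k) p" for k
  define t where "t = fst p"
  let ?x0 = "xc (fixed_curve t)" and ?v0 = "vc (fixed_curve t)"
  have q_Suc: "q (Suc k) = \<phi> (q k)" for k by (simp add: q_def)
  have q_t: "fst (q k) = t" for k
    by (induction k) (simp_all add: q_Suc time, simp add: q_def t_def)
  have x_Suc: "xc (q (Suc k)) - ?x0 = xc (d 0 (0, xc (q k) - ?x0, 0))" for k
  proof -
    have "xc (q (Suc k)) = xc (\<phi> (t, 0)) + xc (d 0 (0, xc (q k), 0))"
      using x_map[of t "xc (q k)" "vc (q k)"] q_t[of k] by (metis prod.collapse q_Suc)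
    then show ?thesis
      by (subst (1) xc_fixed_curve) (simp add: linear_diff[OF linear_x])
  qed
  have "(\<lambda>k. norm (xc (q k) - ?x0)) \<longlonglongrightarrow> 0"
    by (rule perturbed_contraction_tendsto_0[OF exp_c(1,2), of _ "\<lambda>k. 0"])
      (simp_all add: x_Suc x_similarity)
  then have x_lim: "(\<lambda>k. xc (q k)) \<longlonglongrightarrow> ?x0"
    by (rule LIM_zero_cancel[OF tendsto_norm_zero_cancel])
  have v_Suc: "vc (q (Suc k)) - ?v0 = exp (2 * c) * (vc (q k) - ?v0) + (vc (\<phi> (t, xc (q k), 0)) - vc (\<phi> (t, ?x0, 0)))" for k
  proof -
    have "vc (q (Suc k)) = vc (\<phi> (t, xc (q k), 0)) + vc (q k) * exp (2 * c)"
      using v_map[of t "xc (q k)" "vc (q k)"] q_t[of k] by (metis div_by_1 prod.collapse q_Suc)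
    moreover have "?v0 = vc (\<phi> (t, ?x0, 0)) + ?v0 * exp (2 * c)"
      using vc_fixed_curve[of t] exp_c by (simp add: field_simps)
    ultimately show ?thesis by (simp add: algebra_simps)
  qed
  have "(\<lambda>k. vc (\<phi> (t, xc (q k), 0)) - vc (\<phi> (t, ?x0, 0))) \<longlonglongrightarrow> vc (\<phi> (t, ?x0, 0)) - vc (\<phi> (t, ?x0, 0))"
    by (intro tendsto_intros tendsto_\<phi> x_lim)
  then have e: "(\<lambda>k. \<bar>vc (\<phi> (t, xc (q k), 0)) - vc (\<phi> (t, ?x0, 0))\<bar>) \<longlonglongrightarrow> 0"
    using tendsto_rabs_zero by simp
  have "(\<lambda>k. vc (q k) - ?v0) \<longlonglongrightarrow> 0"
    by (rule perturbed_contraction_tendsto_0[OF _ exp_c(3) _ e])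
      (auto simp: v_Suc abs_mult intro: order_trans[OF abs_triangle_ineq])
  then have v_lim: "(\<lambda>k. vc (q k)) \<longlonglongrightarrow> ?v0"
    by (rule LIM_zero_cancel)
  have "(\<lambda>k. (t, xc (q k), vc (q k))) \<longlonglongrightarrow> (t, ?x0, ?v0)"
    by (intro tendsto_intros x_lim v_lim)
  moreover have "(t, xc (q k), vc (q k)) = q k" for k
    using q_t[of k] by (simp add: prod_eq_iff)
  moreover have "(t, ?x0, ?v0) = fixed_curve t"
    by (simp add: prod_eq_iff)
  ultimately show ?thesis by (simp add: q_def t_def)
qed

text \<open>Subtracting the fixed point equations for x at t and s bounds the change of x by that of
  \<open>xc (\<phi> (t, 0))\<close>, divided by 1 - e^c; v is then a continuous expression in t and
  x.\<close>

lemma isCont_fixed_curve: "isCont fixed_curve s"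
proof -
  have fst_lim: "((\<lambda>t. t) \<longlongrightarrow> s) (at s)" by (rule tendsto_ident_at)
  have bound: "norm (xc (fixed_curve t) - xc (fixed_curve s)) \<le> norm (xc (\<phi> (t, 0)) - xc (\<phi> (s, 0))) / (1 - exp c)" for t
  proof -
    have "xc (fixed_curve t) - xc (fixed_curve s) = xc (\<phi> (t, 0)) - xc (\<phi> (s, 0)) + xc (d 0 (0, xc (fixed_curve t) - xc (fixed_curve s), 0))"
      unfolding linear_diff[OF linear_x]
      by (subst xc_fixed_curve[of t], subst xc_fixed_curve[of s]) (rule add_diff_add)
    then have "norm (xc (fixed_curve t) - xc (fixed_curve s)) \<le> norm (xc (\<phi> (t, 0)) - xc (\<phi> (s, 0))) + exp c * norm (xc (fixed_curve t) - xc (fixed_curve s))"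
      using norm_triangle_ineq[of "xc (\<phi> (t, 0)) - xc (\<phi> (s, 0))" "xc (d 0 (0, xc (fixed_curve t) - xc (fixed_curve s), 0))"]
      by (simp add: x_similarity)
    then show ?thesis using exp_c by (simp add: field_simps)
  qed
  have "((\<lambda>t. norm (xc (\<phi> (t, 0)) - xc (\<phi> (s, 0))) / (1 - exp c)) \<longlongrightarrow> norm (xc (\<phi> (s, 0)) - xc (\<phi> (s, 0))) / (1 - exp c)) (at s)"
    by (intro tendsto_intros tendsto_\<phi>) (use exp_c in auto)
  then have lim: "((\<lambda>t. norm (xc (\<phi> (t, 0)) - xc (\<phi> (s, 0))) / (1 - exp c)) \<longlongrightarrow> 0) (at s)"
    by simp
  have "((\<lambda>t. xc (fixed_curve t) - xc (fixed_curve s)) \<longlongrightarrow> 0) (at s)"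
    by (rule Lim_null_comparison[OF _ lim]) (simp add: bound)
  then have x_lim: "((\<lambda>t. xc (fixed_curve t)) \<longlongrightarrow> xc (fixed_curve s)) (at s)"
    by (rule LIM_zero_cancel)
  have "((\<lambda>t. vc (\<phi> (t, xc (fixed_curve t), 0)) / (1 - exp (2 * c))) \<longlongrightarrow> vc (\<phi> (s, xc (fixed_curve s), 0)) / (1 - exp (2 * c))) (at s)"
    by (intro tendsto_intros tendsto_\<phi> x_lim) (use exp_c in auto)
  then have v_lim: "((\<lambda>t. vc (fixed_curve t)) \<longlongrightarrow> vc (fixed_curve s)) (at s)"
    by (simp only: vc_fixed_curve[symmetric])
  have "((\<lambda>t. (t, xc (fixed_curve t), vc (fixed_curve t))) \<longlongrightarrow> (s, xc (fixed_curve s), vc (fixed_curve s))) (at s)"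
    by (intro tendsto_intros x_lim v_lim)
  moreover have "(t, xc (fixed_curve t), vc (fixed_curve t)) = fixed_curve t" for t
    by (simp add: prod_eq_iff)
  ultimately show ?thesis by (simp add: isCont_def)
qed

text \<open>g is constant along the iterates of \<phi>, so by continuity \<open>g p\<close> is its
  value at their limit, which only depends on \<open>fst p\<close>.\<close>

lemma invariant_slice:
  fixes g :: "real \<times> (real^'n) \<times> real \<Rightarrow> real"
  assumes "continuous_on UNIV g" "\<And>p. g (\<phi> p) = g p"
  shows "g p = g (fst p, 0)"
proof -
  have "g p = g (fixed_curve (fst p))" for p
  proof -
    have "g ((\<phi> ^^ k) p) = g p" for k
      by (induction k) (simp_all add: assms(2))
    moreover have "(\<lambda>k. g ((\<phi> ^^ k) p)) \<longlonglongrightarrow> g (fixed_curve (fst p))"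
      by (rule continuous_on_tendsto_compose[OF assms(1) iterates_tendsto_fixed_curve]) auto
    ultimately show ?thesis by (simp add: LIMSEQ_const_iff)
  qed
  from this[of p] this[of "(fst p, 0)"] show ?thesis by simp
qed

text \<open>Supplies \<open>factor_derivative\<close> and \<open>time_derivative\<close> for
  conformal maps commuting with \<phi>.\<close>

lemma invariant_derivative:
  fixes g :: "real \<times> (real^'n) \<times> real \<Rightarrow> real"
  assumes g: "\<And>p. (g has_derivative g' p) (at p)" and inv: "\<And>p. g (\<phi> p) = g p"
  shows "(g has_derivative (\<lambda>X. fst X *\<^sub>R g' p (1, 0, 0))) (at p)"
proof -
  have "continuous_on UNIV g"
    using has_derivative_continuous[OF g] by (simp add: continuous_at_imp_continuous_on)
  note slice = invariant_slice[OF this inv]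
  have "((\<lambda>q. g (fst q, 0)) has_derivative (\<lambda>X. g' (fst p, 0) (fst X, 0))) (at p)"
    by (rule has_derivative_compose[OF _ g]) (auto intro!: derivative_eq_intros)
  then have "(g has_derivative (\<lambda>X. g' (fst p, 0) (fst X, 0))) (at p)"
    by (simp flip: slice)
  from has_derivative_unique[OF g this] have g': "g' p X = g' (fst p, 0) (fst X, 0)" for X
    by (rule fun_cong)
  have "g' p X = fst X *\<^sub>R g' p (1, 0, 0)" for X
    using g'[of X] g'[of "(1, 0, 0)"] linear_cmul[OF has_derivative_linear[OF g], of "(fst p, 0)" "fst X" "(1, 0)"]
    by simp
  with g[of p] show ?thesis by (metis (no_types, lifting) ext)
qed

text \<open>Comparing the factors of \<gamma> \<circ> \<phi> and \<phi> \<circ> \<gamma> gives h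
  \<circ> \<phi> = h, and \<phi> preserves t; so the factor and the time component of \<gamma> are
  invariant functions and \<open>time_affine\<close> applies to \<gamma>.\<close>

lemma commuting_conformal_time:
  assumes nonscalar: "\<nexists>c. S = mat c"
    and conf_\<phi>: "conformal_diffeo UNIV (cw_metric S) UNIV (cw_metric S) \<phi> (\<lambda>p. c)"
    and \<gamma>: "conformal_transformation (cw_metric S) \<gamma>" and comm: "\<gamma> \<circ> \<phi> = \<phi> \<circ> \<gamma>"
  obtains \<epsilon> b where "\<epsilon> = 1 \<or> \<epsilon> = -1" "\<And>p. fst (\<gamma> p) = \<epsilon> * fst p + b"
proof -
  from \<gamma> obtain h where h: "conformal_diffeo UNIV (cw_metric S) UNIV (cw_metric S) \<gamma> h"
    by (auto simp: conformal_transformation_def)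
  note G = conformal_diffeoD[OF h] and P = conformal_diffeoD[OF conf_\<phi>]
  have comm': "\<gamma> (\<phi> q) = \<phi> (\<gamma> q)" for q
    using fun_cong[OF comm, of q] by simp
  have h_inv: "h (\<phi> p) = h p" for p
  proof -
    let ?D = "\<lambda>X. frechet_derivative \<gamma> (at (\<phi> p)) (frechet_derivative \<phi> (at p) X)"
    have "?D X = frechet_derivative \<phi> (at (\<gamma> p)) (frechet_derivative \<gamma> (at p) X)" for X
      using has_derivative_unique[OF smooth_has_derivative_comp[OF G(2) P(2), of p, unfolded comm'] smooth_has_derivative_comp[OF P(2) G(2), of p]]
      by (rule fun_cong)
    then have "cw_metric S (\<gamma> (\<phi> p)) (?D X) (?D Y) = exp (2 * c) * (exp (2 * h p) * cw_metric S p X Y)" for X Y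
      by (simp add: comm' P(5) G(5))
    moreover have "cw_metric S (\<gamma> (\<phi> p)) (?D X) (?D Y) = exp (2 * h (\<phi> p)) * (exp (2 * c) * cw_metric S p X Y)" for X Y
      by (simp add: P(5) G(5))
    \<comment> \<open>These two vectors have product 1 at every point, so the factors can be
      compared.\<close>
    ultimately have "exp (2 * c) * (exp (2 * h p) * cw_metric S p (1,0,0) (0,0,1)) = exp (2 * h (\<phi> p)) * (exp (2 * c) * cw_metric S p (1,0,0) (0,0,1))"
      by metis
    then show ?thesis by (simp add: cw_metric_eq)
  qed
  have t_inv: "fst (\<gamma> (\<phi> p)) = fst (\<gamma> p)" for p
    by (simp add: comm' time)
  interpret \<gamma>: cw_conformal S \<gamma> h "\<lambda>p. frechet_derivative h (at p) (1,0,0)"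
    by (rule cw_conformalI[OF S_sym h invariant_derivative[OF smooth_on_has_derivative[OF G(4) UNIV_I] h_inv]])
  have "((\<lambda>q. fst (\<gamma> q)) has_derivative (\<lambda>X. fst (\<gamma>.d p X))) (at p)" for p
    by (intro has_derivative_fst \<gamma>.has_d)
  note t = this and t' = invariant_derivative[OF this t_inv]
  interpret \<gamma>: cw_conformal_time S \<gamma> h "\<lambda>p. frechet_derivative h (at p) (1,0,0)" "\<lambda>p. fst (\<gamma>.d p (1,0,0))"
  proof
    show "fst (\<gamma>.d p X) = fst X * fst (\<gamma>.d p (1,0,0))" for p X
      using fun_cong[OF has_derivative_unique[OF t t'], of p X] by simp
  qed
  from \<gamma>.time_affine[OF nonscalar] that show ?thesis by metis
qed

end

section \<open>Cocompactness, finiteness criteria and groups of bijections\<close>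

text \<open>The images of the balls of integer radius form an increasing open cover of the orbit
  space; by compactness one of the balls meets every orbit.\<close>

lemma cocompact_covering:
  fixes \<Gamma> :: "('a::heine_borel \<Rightarrow> 'a) set"
  assumes "cocompact \<Gamma>" and id: "id \<in> \<Gamma>"
    and cont: "\<And>\<gamma>. \<gamma> \<in> \<Gamma> \<Longrightarrow> continuous_on UNIV \<gamma>"
    and inv: "\<And>\<gamma>. \<gamma> \<in> \<Gamma> \<Longrightarrow> bij \<gamma> \<and> inv_into UNIV \<gamma> \<in> \<Gamma>"
    and comp: "\<And>\<gamma> \<delta>. \<gamma> \<in> \<Gamma> \<Longrightarrow> \<delta> \<in> \<Gamma> \<Longrightarrow> \<gamma> \<circ> \<delta> \<in> \<Gamma>"
  obtains r where "\<And>q. \<exists>\<gamma>\<in>\<Gamma>. \<exists>k\<in>cball x0 r. q = \<gamma> k"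
proof -
  define W where "W n = group_orbit \<Gamma> ` ball x0 (real n)" for n
  have orbit_eq: "group_orbit \<Gamma> x = group_orbit \<Gamma> y" if "\<gamma> \<in> \<Gamma>" "x = \<gamma> y" for x y \<gamma>
  proof -
    have "\<delta> x \<in> group_orbit \<Gamma> y" if "\<delta> \<in> \<Gamma>" for \<delta>
      using comp[OF that \<open>\<gamma> \<in> \<Gamma>\<close>] \<open>x = \<gamma> y\<close> by (auto simp: group_orbit_def image_iff intro!: bexI[of _ "\<delta> \<circ> \<gamma>"])
    moreover have "\<delta> y \<in> group_orbit \<Gamma> x" if "\<delta> \<in> \<Gamma>" for \<delta>
    proof -
      have "inv_into UNIV \<gamma> x = y"
        using inv[OF \<open>\<gamma> \<in> \<Gamma>\<close>] \<open>x = \<gamma> y\<close> by (simp add: bij_is_inj)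
      then show ?thesis
        using comp[OF that, of "inv_into UNIV \<gamma>"] inv[OF \<open>\<gamma> \<in> \<Gamma>\<close>]
        by (auto simp: group_orbit_def image_iff intro!: bexI[of _ "\<delta> \<circ> inv_into UNIV \<gamma>"])
    qed
    ultimately show ?thesis by (auto simp: group_orbit_def)
  qed
  have orbit_eqD: "\<exists>\<gamma>\<in>\<Gamma>. x = \<gamma> y" if "group_orbit \<Gamma> x = group_orbit \<Gamma> y" for x y
  proof -
    have "x \<in> group_orbit \<Gamma> x" using id by (auto simp: group_orbit_def intro!: image_eqI[of _ _ id])
    with that show ?thesis by (auto simp: group_orbit_def)
  qed
  \<comment> \<open>The preimage is the union of all translates of the ball, which is open because
    inverses lie in \<Gamma> and are continuous.\<close>
  have "group_orbit \<Gamma> -` W n = (\<Union>\<gamma>\<in>\<Gamma>. inv_into UNIV \<gamma> -` ball x0 n)" for n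
  proof (rule equalityI; rule subsetI)
    fix x assume "x \<in> group_orbit \<Gamma> -` W n"
    then obtain y where y: "y \<in> ball x0 n" "group_orbit \<Gamma> x = group_orbit \<Gamma> y" by (auto simp: W_def)
    from orbit_eqD[OF y(2)] obtain \<gamma> where "\<gamma> \<in> \<Gamma>" "x = \<gamma> y" by blast
    then show "x \<in> (\<Union>\<gamma>\<in>\<Gamma>. inv_into UNIV \<gamma> -` ball x0 n)"
      using y(1) inv by (auto simp: bij_is_inj intro!: bexI[of _ \<gamma>])
  next
    fix x assume "x \<in> (\<Union>\<gamma>\<in>\<Gamma>. inv_into UNIV \<gamma> -` ball x0 n)"
    then obtain \<gamma> where \<gamma>: "\<gamma> \<in> \<Gamma>" "inv_into UNIV \<gamma> x \<in> ball x0 n" by auto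
    have "x = \<gamma> (inv_into UNIV \<gamma> x)"
      using inv[OF \<gamma>(1)] by (simp add: bij_is_surj surj_f_inv_f)
    from orbit_eq[OF \<gamma>(1) this] \<gamma>(2) show "x \<in> group_orbit \<Gamma> -` W n" by (auto simp: W_def)
  qed
  moreover have "open (\<Union>\<gamma>\<in>\<Gamma>. inv_into UNIV \<gamma> -` ball x0 n)" for n :: nat
    using cont inv by (intro open_UN ballI open_vimage) auto
  ultimately have "openin (orbit_space \<Gamma>) (W n)" for n
    unfolding openin_orbit_space by (auto simp: W_def)
  moreover have top: "topspace (orbit_space \<Gamma>) = range (group_orbit \<Gamma>)"
  proof
    show "topspace (orbit_space \<Gamma>) \<subseteq> range (group_orbit \<Gamma>)"
      using openin_topspace[of "orbit_space \<Gamma>"] unfolding openin_orbit_space by blast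
    have "group_orbit \<Gamma> -` range (group_orbit \<Gamma>) = UNIV" by auto
    then have "openin (orbit_space \<Gamma>) (range (group_orbit \<Gamma>))"
      by (simp add: openin_orbit_space)
    then show "range (group_orbit \<Gamma>) \<subseteq> topspace (orbit_space \<Gamma>)"
      by (rule openin_subset)
  qed
  moreover have "topspace (orbit_space \<Gamma>) \<subseteq> \<Union>(range W)"
  proof -
    have "\<exists>n. group_orbit \<Gamma> x \<in> W n" for x
    proof -
      obtain n :: nat where "dist x0 x < n" using reals_Archimedean2 by blast
      then show ?thesis by (intro exI[of _ n]) (simp add: W_def)
    qed
    then show ?thesis unfolding top by blast
  qed
  ultimately obtain \<F> where \<F>: "finite \<F>" "\<F> \<subseteq> range W" "range (group_orbit \<Gamma>) \<subseteq> \<Union>\<F>"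
    using assms(1) unfolding cocompact_def compact_space_alt by (metis (no_types, lifting) rangeE)
  obtain N where N: "finite N" "\<F> = W ` N"
    using finite_subset_image[OF \<F>(1,2)] by blast
  have "\<exists>\<gamma>\<in>\<Gamma>. \<exists>k\<in>cball x0 (real (Max N)). q = \<gamma> k" for q
  proof -
    obtain n where n: "n \<in> N" "group_orbit \<Gamma> q \<in> W n"
      using \<F>(3) N(2) by blast
    then obtain y where y: "dist x0 y < n" "group_orbit \<Gamma> q = group_orbit \<Gamma> y" by (auto simp: W_def)
    have "n \<le> Max N" using n(1) N(1) by simp
    then have "y \<in> cball x0 (real (Max N))" using y(1) by (simp add: order_trans[OF less_imp_le])
    with orbit_eqD[OF y(2)] show ?thesis by blast
  qed
  then show ?thesis by (rule that)
qed

text \<open>The translates meeting the slice t = 0 would be finitely many compact sets covering it,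
  but the slice is unbounded in v.\<close>

lemma slice_not_covered:
  fixes K :: "(real \<times> 'a::euclidean_space \<times> real) set" and \<Gamma> :: "(real \<times> 'a \<times> real \<Rightarrow> real \<times> 'a \<times> real) set"
  assumes "compact K" "\<And>\<gamma>. \<gamma> \<in> \<Gamma> \<Longrightarrow> continuous_on UNIV \<gamma>"
    and fin: "finite {\<gamma> \<in> \<Gamma>. \<exists>k\<in>K. fst (\<gamma> k) = 0}"
    and cover: "\<And>q. \<exists>\<gamma>\<in>\<Gamma>. \<exists>k\<in>K. q = \<gamma> k"
  shows False
proof -
  let ?H = "{\<gamma> \<in> \<Gamma>. \<exists>k\<in>K. fst (\<gamma> k) = (0::real)}"
  have "compact (\<Union>\<gamma>\<in>?H. \<gamma> ` K)"
    using fin assms(1,2) by (intro compact_UN compact_continuous_image) (auto intro: continuous_on_subset)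
  then have "bounded (\<Union>\<gamma>\<in>?H. \<gamma> ` K)"
    by (rule compact_imp_bounded)
  then obtain B where B: "\<And>q. q \<in> (\<Union>\<gamma>\<in>?H. \<gamma> ` K) \<Longrightarrow> norm q \<le> B"
    unfolding bounded_iff by blast
  obtain \<gamma> k where k: "\<gamma> \<in> \<Gamma>" "k \<in> K" "(0, 0, \<bar>B\<bar> + 1) = \<gamma> k"
    using cover by blast
  then have "fst (\<gamma> k) = 0" by (metis fst_conv)
  with k have "(0, 0, \<bar>B\<bar> + 1) \<in> (\<Union>\<gamma>\<in>?H. \<gamma> ` K)" by auto
  from B[OF this] show False by simp
qed


text \<open>Elements in the same cell of length \<delta> coincide, and the bound leaves finitely
  many cells.\<close>

lemma finite_if_separated:
  fixes g :: "'a \<Rightarrow> real"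
  assumes "\<delta> > 0" and sep: "\<And>x y. x \<in> A \<Longrightarrow> y \<in> A \<Longrightarrow> \<bar>g x - g y\<bar> < \<delta> \<Longrightarrow> x = y"
    and bound: "\<And>x. x \<in> A \<Longrightarrow> \<bar>g x\<bar> \<le> r"
  shows "finite A"
proof (rule finite_imageD)
  show "inj_on (\<lambda>x. \<lfloor>g x / \<delta>\<rfloor>) A"
  proof (rule inj_onI)
    fix x y assume xy: "x \<in> A" "y \<in> A" "\<lfloor>g x / \<delta>\<rfloor> = \<lfloor>g y / \<delta>\<rfloor>"
    then have "\<bar>g x / \<delta> - g y / \<delta>\<bar> < 1" by linarith
    then have "\<bar>g x - g y\<bar> < \<delta>"
      using \<open>\<delta> > 0\<close> by (simp add: abs_less_iff field_simps)
    with sep xy show "x = y" by blast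
  qed
  have "(\<lambda>x. \<lfloor>g x / \<delta>\<rfloor>) ` A \<subseteq> {\<lfloor>- r / \<delta>\<rfloor>..\<lfloor>r / \<delta>\<rfloor>}"
  proof (rule image_subsetI)
    fix x assume "x \<in> A"
    from bound[OF this] have "- r \<le> g x" "g x \<le> r" by auto
    then have "- r / \<delta> \<le> g x / \<delta>" "g x / \<delta> \<le> r / \<delta>"
      using \<open>\<delta> > 0\<close> by (auto intro!: divide_right_mono simp del: divide_minus_left)
    then show "\<lfloor>g x / \<delta>\<rfloor> \<in> {\<lfloor>- r / \<delta>\<rfloor>..\<lfloor>r / \<delta>\<rfloor>}" by (simp add: floor_mono)
  qed
  then show "finite ((\<lambda>x. \<lfloor>g x / \<delta>\<rfloor>) ` A)"
    by (rule finite_subset) simp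
qed

lemma subgroup_BijGroup_UNIV:
  assumes "subgroup \<Gamma> (BijGroup UNIV)"
  shows "id \<in> \<Gamma>" "\<gamma> \<in> \<Gamma> \<Longrightarrow> bij \<gamma>" "\<gamma> \<in> \<Gamma> \<Longrightarrow> inv_into UNIV \<gamma> \<in> \<Gamma>"
    "\<gamma> \<in> \<Gamma> \<Longrightarrow> \<delta> \<in> \<Gamma> \<Longrightarrow> \<gamma> \<circ> \<delta> \<in> \<Gamma>"
proof -
  have sub: "\<gamma> \<in> carrier (BijGroup UNIV)" if "\<gamma> \<in> \<Gamma>" for \<gamma>
    using that subgroup.subset[OF assms] by blast
  then have Bij: "\<gamma> \<in> Bij UNIV" if "\<gamma> \<in> \<Gamma>" for \<gamma>
    using that by (auto simp: BijGroup_def)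
  show "id \<in> \<Gamma>"
    using subgroup.one_closed[OF assms] by (simp add: BijGroup_def id_def restrict_UNIV)
  show "bij \<gamma>" if "\<gamma> \<in> \<Gamma>"
    using Bij[OF that] by (simp add: Bij_def)
  show "inv_into UNIV \<gamma> \<in> \<Gamma>" if "\<gamma> \<in> \<Gamma>"
    using subgroup.m_inv_closed[OF assms that] inv_BijGroup[OF Bij[OF that]] by (simp add: restrict_UNIV)
  show "\<gamma> \<circ> \<delta> \<in> \<Gamma>" if "\<gamma> \<in> \<Gamma>" "\<delta> \<in> \<Gamma>"
    using subgroup.m_closed[OF assms that] Bij that by (simp add: BijGroup_def compose_def comp_def restrict_UNIV)
qed

lemma properly_discontinuousD:
  assumes "properly_discontinuous \<Gamma>"
  obtains U where "open U" "x \<in> U" "\<And>\<gamma>. \<gamma> \<in> \<Gamma> \<Longrightarrow> \<gamma> x \<in> U \<Longrightarrow> \<gamma> = id"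
proof -
  from assms obtain U where "open U" "x \<in> U" "\<forall>\<gamma>\<in>\<Gamma>. \<gamma> ` U \<inter> U \<noteq> {} \<longrightarrow> \<gamma> = id"
    unfolding properly_discontinuous_def by blast
  then show ?thesis by (intro that[of U]) auto
qed

theorem theorem1p3:
  fixes S :: "real^'n^'n"
    and \<eta> :: "real \<times> (real^'n) \<times> real \<Rightarrow> real \<times> (real^'n) \<times> real"
    and \<Gamma> :: "(real \<times> (real^'n) \<times> real \<Rightarrow> real \<times> (real^'n) \<times> real) set"
  assumes "transpose S = S" and "det S \<noteq> 0"
    and "\<not> conformally_flat_on UNIV (cw_metric S)"
    and "homothety (cw_metric S) \<eta>" and "essential (cw_metric S) \<eta>"
    and "subgroup \<Gamma> (BijGroup UNIV)"
    and "\<forall>\<gamma>\<in>\<Gamma>. conformal_transformation (cw_metric S) \<gamma>"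
    and "\<forall>\<gamma>\<in>\<Gamma>. \<gamma> \<circ> \<eta> = \<eta> \<circ> \<gamma>"
  shows "\<not> (properly_discontinuous \<Gamma> \<and> cocompact \<Gamma>)"
proof
  assume "properly_discontinuous \<Gamma> \<and> cocompact \<Gamma>"
  then have PD: "properly_discontinuous \<Gamma>" and "cocompact \<Gamma>" by auto
  have nonscalar: "\<nexists>c. S = mat c"
    using assms(3) scalar_conformally_flat by blast
  note group = subgroup_BijGroup_UNIV[OF assms(6)]
  have cont: "continuous_on UNIV \<gamma>" if "\<gamma> \<in> \<Gamma>" for \<gamma>
    using assms(7) that smooth_on_continuous conformal_diffeoD(2) unfolding conformal_transformation_def by blast
  obtain r where cover: "\<And>q. \<exists>\<gamma>\<in>\<Gamma>. \<exists>k\<in>cball 0 r. q = \<gamma> k"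
    using cocompact_covering[OF \<open>cocompact \<Gamma>\<close> group(1) cont _ group(4)] group(2,3) by blast
  obtain \<zeta> c \<alpha> \<beta> where \<zeta>: "cw_homothety S \<zeta> c \<alpha> \<beta>" "c < 0" "\<alpha> = 1 \<longrightarrow> \<beta> = 0"
    "conformal_diffeo UNIV (cw_metric S) UNIV (cw_metric S) \<zeta> (\<lambda>p. c)"
    and comm: "\<forall>\<gamma>. \<gamma> \<circ> \<eta> = \<eta> \<circ> \<gamma> \<longrightarrow> \<gamma> \<circ> \<zeta> = \<zeta> \<circ> \<gamma>"
    by (rule contracting_homothety[OF assms(1,2) nonscalar assms(4,5)])
  have \<gamma>\<zeta>: "\<gamma> (\<zeta> p) = \<zeta> (\<gamma> p)" if "\<gamma> \<in> \<Gamma>" for \<gamma> p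
    using fun_cong[OF comm[rule_format], of \<gamma> p] assms(8) that by simp
  interpret cw_homothety S \<zeta> c \<alpha> \<beta> by (rule \<zeta>)
  \<comment> \<open>This finiteness contradicts the covering by
    \<open>slice_not_covered\<close>.\<close>
  have "finite {\<gamma> \<in> \<Gamma>. \<exists>k\<in>cball 0 r. fst (\<gamma> k) = 0}"
  proof (cases "\<alpha> = 1")
    case True
    interpret cw_contraction S \<zeta> c
      using \<zeta> True by (simp add: cw_contraction_def cw_contraction_axioms_def)
    obtain U where U: "open U" "fixed_curve 0 \<in> U" "\<And>\<gamma>. \<gamma> \<in> \<Gamma> \<Longrightarrow> \<gamma> (fixed_curve 0) \<in> U \<Longrightarrow> \<gamma> = id"
      using properly_discontinuousD[OF PD] by blast
    have "\<forall>\<^sub>F t in at 0. fixed_curve t \<in> U"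
      using isCont_fixed_curve[of 0] U(1,2) by (simp add: isCont_def tendsto_def)
    then obtain \<delta> where \<delta>: "\<delta> > 0" "\<And>t. \<bar>t\<bar> < \<delta> \<Longrightarrow> fixed_curve t \<in> U"
      unfolding eventually_at using U(2) by (metis UNIV_I dist_real_def diff_zero)
    have time_\<gamma>: "\<exists>\<epsilon> b. (\<epsilon> = 1 \<or> \<epsilon> = -1) \<and> (\<forall>p. fst (\<gamma> p) = \<epsilon> * fst p + b)" if "\<gamma> \<in> \<Gamma>" for \<gamma>
      using commuting_conformal_time[OF nonscalar \<zeta>(4), of \<gamma>] assms(7,8) comm that by metis
    \<comment> \<open>Commuting with \<zeta>, \<gamma> maps fixed points of \<zeta> to fixed
      points.\<close>
    have fixed_curve_\<gamma>: "\<gamma> (fixed_curve 0) = fixed_curve (fst (\<gamma> (fixed_curve 0)))" if "\<gamma> \<in> \<Gamma>" for \<gamma>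
      by (rule fixed_imp_fixed_curve) (simp add: fixed_curve_fixed flip: \<gamma>\<zeta>[OF that])
    show ?thesis
    \<comment> \<open>An element is recorded by the time to which it moves
      \<open>fixed_curve 0\<close>.\<close>
    proof (rule finite_if_separated[OF \<delta>(1)])
      fix \<gamma> \<gamma>'
      assume \<gamma>: "\<gamma> \<in> {\<gamma> \<in> \<Gamma>. \<exists>k\<in>cball 0 r. fst (\<gamma> k) = 0}" and \<gamma>': "\<gamma>' \<in> {\<gamma> \<in> \<Gamma>. \<exists>k\<in>cball 0 r. fst (\<gamma> k) = 0}"
        and close: "\<bar>fst (\<gamma> (fixed_curve 0)) - fst (\<gamma>' (fixed_curve 0))\<bar> < \<delta>"
      define \<sigma> where "\<sigma> = inv_into UNIV \<gamma> \<circ> \<gamma>'"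
      have \<sigma>: "\<sigma> \<in> \<Gamma>" using group \<gamma> \<gamma>' by (simp add: \<sigma>_def)
      have \<gamma>\<sigma>: "\<gamma> (\<sigma> p) = \<gamma>' p" for p
        using group(2)[of \<gamma>] \<gamma> by (simp add: \<sigma>_def bij_is_surj surj_f_inv_f)
      obtain \<epsilon> b where \<epsilon>: "\<epsilon> = 1 \<or> \<epsilon> = -1" "\<And>p. fst (\<gamma> p) = \<epsilon> * fst p + b"
        using time_\<gamma> \<gamma> by blast
      \<comment> \<open>\<gamma> preserves time differences up to sign, so \<sigma> moves
        \<open>fixed_curve 0\<close> along the curve by less than \<delta>, hence into U, and is
        trivial.\<close>
      have "fst (\<gamma>' (fixed_curve 0)) - fst (\<gamma> (fixed_curve 0)) = \<epsilon> * fst (\<sigma> (fixed_curve 0))"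
        using \<epsilon>(2)[of "\<sigma> (fixed_curve 0)"] \<epsilon>(2)[of "fixed_curve 0"] by (simp add: \<gamma>\<sigma>)
      with close \<epsilon>(1) have "\<bar>fst (\<sigma> (fixed_curve 0))\<bar> < \<delta>" by auto
      then have "\<sigma> (fixed_curve 0) \<in> U"
        using \<delta>(2) fixed_curve_\<gamma>[OF \<sigma>] by metis
      then have "\<sigma> = id" by (rule U(3)[OF \<sigma>])
      with \<gamma>\<sigma> show "\<gamma> = \<gamma>'" by auto
    next
      fix \<gamma> assume \<gamma>: "\<gamma> \<in> {\<gamma> \<in> \<Gamma>. \<exists>k\<in>cball 0 r. fst (\<gamma> k) = 0}"
      then obtain k where k: "norm k \<le> r" "fst (\<gamma> k) = 0" by auto
      obtain \<epsilon> b where \<epsilon>: "\<epsilon> = 1 \<or> \<epsilon> = -1" "\<And>p. fst (\<gamma> p) = \<epsilon> * fst p + b"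
        using time_\<gamma> \<gamma> by blast
      have "\<bar>fst k\<bar> \<le> r" using norm_fst_le[of "fst k" "snd k"] k(1) by simp
      \<comment> \<open>The time of this image is b, and \<epsilon> \<open>fst k\<close> + b = 0
        gives \<bar>b\<bar> = \<bar>\<open>fst k\<close>\<bar>.\<close>
      then show "\<bar>fst (\<gamma> (fixed_curve 0))\<bar> \<le> r"
        using \<epsilon>(1) \<epsilon>(2)[of k] \<epsilon>(2)[of "fixed_curve 0"] k(2) by auto
    qed
  next
    case False
    with sign have \<alpha>: "\<alpha> = -1" by simp
    \<comment> \<open>\<beta> / 2 is the only fixed time of t \<mapsto> - t + \<beta>, so \<zeta>
      has a single fixed point, which \<Gamma> must fix.\<close>
    obtain y where y: "\<zeta> (\<beta> / 2, y) = (\<beta> / 2, y)" "\<And>y'. \<zeta> (\<beta> / 2, y') = (\<beta> / 2, y') \<Longrightarrow> y' = y"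
      using ex1_fixed_point[of "\<beta> / 2"] \<zeta>(2) \<alpha> by auto
    have unique: "q = (\<beta> / 2, y)" if "\<zeta> q = q" for q
    proof -
      have "fst q = \<beta> / 2" using time[of q] that \<alpha> by simp
      then have "q = (\<beta> / 2, snd q)" by (simp add: prod_eq_iff)
      with y(2)[of "snd q"] that show ?thesis by metis
    qed
    obtain U where U: "(\<beta> / 2, y) \<in> U" "\<And>\<gamma>. \<gamma> \<in> \<Gamma> \<Longrightarrow> \<gamma> (\<beta> / 2, y) \<in> U \<Longrightarrow> \<gamma> = id"
      using properly_discontinuousD[OF PD] by blast
    have "\<gamma> = id" if "\<gamma> \<in> \<Gamma>" for \<gamma>
    proof (rule U(2)[OF that])
      have "\<gamma> (\<beta> / 2, y) = (\<beta> / 2, y)"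
        by (rule unique) (simp add: y(1) flip: \<gamma>\<zeta>[OF that])
      then show "\<gamma> (\<beta> / 2, y) \<in> U" using U(1) by simp
    qed
    then have "{\<gamma> \<in> \<Gamma>. \<exists>k\<in>cball 0 r. fst (\<gamma> k) = 0} \<subseteq> {id}" by blast
    then show ?thesis by (rule finite_subset) simp
  qed
  from slice_not_covered[OF compact_cball cont this cover] show False .
qed

end
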